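(* Let $L$ be a (full-rank) sublattice of $\mathbb{H}$ and let $B\in\mathbb{N}$ be the positive integer such that $B\mathbb{Z}=[\mathbb{H}:L](\mathfrak{n}L)^{-1}$. Then \[ \zeta_L^{\mathrm{SL}}(s)=\zeta(s-1)\sum_{b \mid B} (B/b)^{-s}\left( \lvert U_b^2\rvert - \sum_{\boldsymbol{w}\in W(b)} c_b(\boldsymbol{w}) \prod_{u \in U_b^2 } \frac{\mathrm{Sym}_{w_u}(\{p^{-s} : p \in \mathcal{P}_u^{(b)} \} )}{\prod_{p \in \mathcal{P}_u^{(b)}}(1-p^{-s})^{-1}} \right), \] where $b$ runs over positive divisors of $B$.
   Context: $\mathbb{H}=\mathbb{Z}e_1+\mathbb{Z}e_2$ is the free rank-2 $\mathbb{Z}$-module with quadratic form $Q$ and symmetric bilinear form $B(x,y)=\frac12(Q(x+y)-Q(x)-Q(y))$ given by $Q(e_1)=Q(e_2)=0$, $B(e_1,e_2)=\frac12$ (so $Q(xe_1+ye_2)=xy$). A sublattice means a subgroup of rank 2 (finite index), with the restricted form. The norm ideal $\mathfrak{n}L$ is the ideal of $\mathbb{Z}$ generated by all $Q(x)$, $x\in L$; $[\mathbb{H}:L]$ is the index; $[\mathbb{H}:L](\mathfrak{n}L)^{-1}$ is a product of fractional ideals of $\mathbb{Z}$, and it is of the form $B\mathbb{Z}$ with $B\in\mathbb{N}$. Let $V=\mathbb{Q}L$. $O(V)=\{\sigma\in\mathrm{GL}(V): B(\sigma x,\sigma y)=B(x,y)\ \forall x,y\in V\}$ and $O^+(V)=O(V)\cap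 \mathrm{SL}(V)$. Two lattices $K_1,K_2$ in $V$ are properly isometric if $\sigma(K_1)=K_2$ for some $\sigma\in O^+(V)$. For $m\in\mathbb{N}$, $a_m^+(L)$ is the number of proper isometry classes among the sublattices $K\subseteq L$ with $[L:K]=m$, and $\zeta_L^{\mathrm{SL}}(s)=\sum_{m\ge1}a_m^+(L)m^{-s}$. $\zeta(s)$ is the Riemann zeta function. The identity is an identity of Dirichlet series (for $\Re(s)>2$). For $b\in\mathbb{N}$: $U_b=(\mathbb{Z}/b\mathbb{Z})^\times$ and $U_b^2=\{a^2:a\in U_b\}$. For $u\in U_b^2$, $\mathcal{P}_u^{(b)}=\{p \text{ prime}: p^2\equiv u \pmod b\}$. $W=W(b)$ is the set of all tuples $\boldsymbol{w}=(w_u)_{u\in U_b^2}$ of nonnegative integers. For $t\in U_b^2$, $\mathcal{S}_t=\{\boldsymbol{w}\in W: \prod_{u\in U_b^2}u^{w_u}\equiv t \pmod b\}$ and $\mathcal{T}_t=\mathcal{S}_t+W$ (sumset, componentwise addition). $c_b(\boldsymbol{w})=\#\{t\in U_b^2:\boldsymbol{w}\notin\mathcal{T}_t\}$. For an infinite list $X=(x_1,x_2,\ldots)$ and $k\ge0$, $\mathrm{Sym}_k(X)=\sum_{1\le i_1\le\cdots\le i_k}x_{i_1}\cdots x_{i_k}$ is the complete homogeneous symmetric function (with $\mathrm{Sym}_0=1$). *)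

theory Defs
  imports "HOL-Analysis.Analysis" "HOL-Library.Set_Algebras" "HOL-Number_Theory.Cong"
begin

section \<open>The hyperbolic plane and its sublattices\<close>

text \<open>The quadratic space is \<open>rat ^ 2\<close>; \<open>x $ 1\<close> and \<open>x $ 2\<close> are the coordinates of \<open>x\<close> with respect
  to the isotropic basis \<open>e\<^sub>1, e\<^sub>2\<close>, so that \<open>Q(e\<^sub>1) = Q(e\<^sub>2) = 0\<close> and \<open>B(e\<^sub>1, e\<^sub>2) = 1/2\<close>.\<close>

definition Q :: "rat ^ 2 \<Rightarrow> rat" where
  "Q x = x $ 1 * x $ 2"

definition bilin :: "rat ^ 2 \<Rightarrow> rat ^ 2 \<Rightarrow> rat" where
  "bilin x y = 1 / 2 * (Q (x + y) - Q x - Q y)"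

definition hyp :: "(rat ^ 2) set" where
  "hyp = {x. x $ 1 \<in> \<int> \<and> x $ 2 \<in> \<int>}"

definition add_subgroup :: "'a :: ab_group_add set \<Rightarrow> bool" where
  "add_subgroup K \<longleftrightarrow> 0 \<in> K \<and> (\<forall>x\<in>K. \<forall>y\<in>K. x - y \<in> K)"

definition cosets :: "'a :: ab_group_add set \<Rightarrow> 'a set \<Rightarrow> 'a set set" where
  "cosets L K = (\<lambda>x. x +o K) ` L"

definition lat_index :: "'a :: ab_group_add set \<Rightarrow> 'a set \<Rightarrow> nat" where
  "lat_index L K = card (cosets L K)"

definition sublattice :: "(rat ^ 2) set \<Rightarrow> (rat ^ 2) set \<Rightarrow> bool" where
  "sublattice K L \<longleftrightarrow> K \<subseteq> L \<and> add_subgroup K \<and> finite (cosets L K)"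

text \<open>Fractional ideals of \<open>\<int>\<close> are treated as additive subgroups of \<open>rat\<close>. For a sublattice of \<open>hyp\<close>
  the values of \<open>Q\<close> are integers, so the additive subgroup they generate is an ideal of \<open>\<int>\<close>.\<close>

definition norm_ideal :: "(rat ^ 2) set \<Rightarrow> rat set" where
  "norm_ideal L = add_subgroup hull (Q ` L)"

definition ideal_inverse :: "rat set \<Rightarrow> rat set" where
  "ideal_inverse I = {y. \<forall>x\<in>I. x * y \<in> \<int>}"


section \<open>Proper isometry classes and the zeta function\<close>

definition orth_group :: "(rat ^ 2 ^ 2) set" where
  "orth_group = {\<sigma>. invertible \<sigma> \<and> (\<forall>x y. bilin (\<sigma> *v x) (\<sigma> *v y) = bilin x y)}"

definition proper_orth_group :: "(rat ^ 2 ^ 2) set" where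
  "proper_orth_group = {\<sigma> \<in> orth_group. det \<sigma> = 1}"

definition properly_isometric :: "(rat ^ 2) set \<Rightarrow> (rat ^ 2) set \<Rightarrow> bool" where
  "properly_isometric K\<^sub>1 K\<^sub>2 \<longleftrightarrow> (\<exists>\<sigma>\<in>proper_orth_group. (\<lambda>x. \<sigma> *v x) ` K\<^sub>1 = K\<^sub>2)"

definition num_proper_classes :: "(rat ^ 2) set \<Rightarrow> nat \<Rightarrow> nat" where
  "num_proper_classes L m =
     card ({K. sublattice K L \<and> lat_index L K = m} // {(K\<^sub>1, K\<^sub>2). properly_isometric K\<^sub>1 K\<^sub>2})"

definition zeta_SL :: "(rat ^ 2) set \<Rightarrow> complex \<Rightarrow> complex" where
  "zeta_SL L s = (\<Sum>\<^sub>\<infinity>m\<in>{1..}. of_nat (num_proper_classes L m) * of_nat m powr (-s))"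

text \<open>The Riemann zeta function on its half-plane of convergence \<open>Re s > 1\<close>.\<close>

definition zeta :: "complex \<Rightarrow> complex" where
  "zeta s = (\<Sum>\<^sub>\<infinity>n\<in>{1..}. of_nat n powr (-s))"


section \<open>Combinatorial data modulo \<open>b\<close>\<close>

text \<open>Residue classes modulo \<open>b \<ge> 1\<close> are represented by \<open>{0..<b}\<close>. For \<open>b = 1\<close> the unique unit is \<open>0\<close>.\<close>

definition unit_residues :: "nat \<Rightarrow> nat set" where
  "unit_residues b = {a \<in> {0..<b}. coprime a b}"

definition square_residues :: "nat \<Rightarrow> nat set" where
  "square_residues b = (\<lambda>a. a\<^sup>2 mod b) ` unit_residues b"

definition primes_sq :: "nat \<Rightarrow> nat \<Rightarrow> nat set" where
  "primes_sq b u = {p. prime p \<and> [p\<^sup>2 = u] (mod b)}"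

definition tuples :: "nat \<Rightarrow> (nat \<Rightarrow> nat) set" where
  "tuples b = square_residues b \<rightarrow>\<^sub>E UNIV"

definition tuples_S :: "nat \<Rightarrow> nat \<Rightarrow> (nat \<Rightarrow> nat) set" where
  "tuples_S b t = {w \<in> tuples b. [(\<Prod>u\<in>square_residues b. u ^ w u) = t] (mod b)}"

definition tuples_T :: "nat \<Rightarrow> nat \<Rightarrow> (nat \<Rightarrow> nat) set" where
  "tuples_T b t = {\<lambda>u\<in>square_residues b. v u + w u | v w. v \<in> tuples_S b t \<and> w \<in> tuples b}"

definition c_coeff :: "nat \<Rightarrow> (nat \<Rightarrow> nat) \<Rightarrow> nat" where
  "c_coeff b w = card {t \<in> square_residues b. w \<notin> tuples_T b t}"

text \<open>The complete homogeneous symmetric function of degree \<open>k\<close> in the list \<open>(x\<^sub>i)\<close>, \<open>i \<in> I\<close>; the weakly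
  increasing sequences \<open>i\<^sub>1 \<le> \<dots> \<le> i\<^sub>k\<close> are the sorted lists of length \<open>k\<close> over \<open>I\<close>.\<close>

definition Sym :: "nat \<Rightarrow> nat set \<Rightarrow> (nat \<Rightarrow> complex) \<Rightarrow> complex" where
  "Sym k I x = (\<Sum>\<^sub>\<infinity>is\<in>{is. length is = k \<and> sorted is \<and> set is \<subseteq> I}. \<Prod>i\<leftarrow>is. x i)"

definition euler_prod :: "nat set \<Rightarrow> complex \<Rightarrow> complex" where
  "euler_prod P s = (\<Prod>n. if n \<in> P then inverse (1 - of_nat n powr (-s)) else 1)"

definition W_term :: "nat \<Rightarrow> complex \<Rightarrow> (nat \<Rightarrow> nat) \<Rightarrow> complex" where
  "W_term b s w = of_nat (c_coeff b w) *
     (\<Prod>u\<in>square_residues b.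
        Sym (w u) (primes_sq b u) (\<lambda>p. of_nat p powr (-s)) / euler_prod (primes_sq b u) s)"

end

theory Submission
  imports Defs
begin

text \<open>
  Since \<open>e\<^sub>1\<close> and \<open>e\<^sub>2\<close> are isotropic, the proper orthogonal group of the hyperbolic plane is the
  torus of the maps \<open>(y, z) \<mapsto> (c y, z / c)\<close>. Every lattice has a triangular basis
  \<open>(a, 0), (x, d)\<close>, and the torus leaves precisely the covolume \<open>a d\<close> and the offset \<open>x / a\<close> modulo
  \<open>1\<close> unchanged; together they classify lattices up to proper isometry
  (\<open>properly_isometric_lat_iff\<close>). Sublattices of a fixed index have a fixed covolume, so only the
  offset counts: for a lattice of offset \<open>\<xi>\<close> the coefficient \<open>a\<^sub>m\<^sup>+(L)\<close> is the number of
  \<open>r \<in> \<rat>/\<int>\<close> such that \<open>t r = n \<xi>\<close> for some factorization \<open>m = t n\<close>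
  (\<open>num_proper_classes_lat\<close>). The integer \<open>B\<close> is the order of \<open>\<xi>\<close> in \<open>\<rat>/\<int>\<close>
  (\<open>lat_offset_lowest_terms\<close>), say \<open>\<xi> = k / B\<close>.

  To count these \<open>r\<close>, write \<open>r = \<rho> / N\<close> in lowest terms and let \<open>b\<close> be the order of the common
  value \<open>t r = n \<xi>\<close>. It divides both \<open>B\<close> and \<open>N = b h\<close>, and cancelling common factors gives
  \<open>m = (B / b) h M\<close> with \<open>M = t' n'\<close> coprime to \<open>b\<close> and \<open>t' \<rho> \<equiv> n' k\<close> modulo \<open>b\<close>, that is
  \<open>t'\<^sup>2 \<rho> \<equiv> M k\<close>. As \<open>M / b\<^sup>2\<close> is the reduced form of \<open>m / (B N)\<close>, the triple \<open>(b, h, M)\<close> is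
  determined by \<open>r\<close>. For a fixed triple, the residue of \<open>\<rho>\<close> modulo \<open>b\<close> runs through as many units as
  there are squares \<open>t'\<^sup>2\<close> modulo \<open>b\<close> of divisors of \<open>M\<close>, and each unit has the same number of lifts
  to a unit modulo \<open>b h\<close> (\<open>card_unit_lifts\<close>, \<open>card_admissible_rationals\<close>).

  The Dirichlet series therefore splits, for each \<open>b\<close>, into \<open>(B / b)\<^sup>-\<^sup>s\<close>, a series over \<open>h\<close>, and a
  series over \<open>M\<close>. Sorting the residues in a class modulo \<open>b\<close> by their greatest common divisor with
  \<open>b h\<close> shows that the first series is \<open>\<zeta>(s - 1) / \<zeta>\<^sub>b(s)\<close>, where \<open>\<zeta>\<^sub>b(s)\<close> sums \<open>n\<^sup>-\<^sup>s\<close> over the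
  integers coprime to \<open>b\<close> (\<open>zeta_shift_conv_lift_count\<close>). In the second series the number of squares
  depends only on how many prime factors of \<open>M\<close> have square \<open>u\<close>, for each square \<open>u\<close> modulo \<open>b\<close>. If
  these numbers are \<open>w\<^sub>u\<close>, it equals \<open>|U\<^sub>b\<^sup>2| - c\<^sub>b(w)\<close> (\<open>c_coeff_factor_type\<close>), and the sum of \<open>M\<^sup>-\<^sup>s\<close>
  over all \<open>M\<close> of this type is the product of the symmetric functions of degree \<open>w\<^sub>u\<close>. Unique
  factorization, used once with and once without the restriction to a type, turns the second series
  divided by \<open>\<zeta>\<^sub>b(s)\<close> into the bracket of the theorem (\<open>W_term_sum\<close>).
\<close>

section \<open>Lattices in the hyperbolic plane and their proper classes\<close>

definition lat :: "rat \<Rightarrow> rat \<Rightarrow> rat \<Rightarrow> (rat ^ 2) set" where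
  "lat a x d = {v. \<exists>i j :: int. v $ 1 = of_int i * a + of_int j * x \<and> v $ 2 = of_int j * d}"

lemma vec2_eq_iff: "v = w \<longleftrightarrow> v $ 1 = w $ 1 \<and> v $ 2 = w $ 2" for v w :: "rat ^ 2"
  by (simp add: vec_eq_iff forall_2)

lemma vector_in_lat_iff:
  "vector [p, q] \<in> lat a x d \<longleftrightarrow> (\<exists>i j :: int. p = of_int i * a + of_int j * x \<and> q = of_int j * d)"
  by (simp add: lat_def)

lemma hyp_eq_lat: "hyp = lat 1 0 1"
  by (auto simp: hyp_def lat_def elim!: Ints_cases)

lemma add_subgroup_lat: "add_subgroup (lat a x d)"
  unfolding add_subgroup_def
proof (intro conjI ballI)
  show "0 \<in> lat a x d"
    unfolding lat_def by (auto intro!: exI[of _ 0])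
  fix v w assume "v \<in> lat a x d" "w \<in> lat a x d"
  then obtain i j k l :: int where
    "v $ 1 = of_int i * a + of_int j * x" "v $ 2 = of_int j * d"
    "w $ 1 = of_int k * a + of_int l * x" "w $ 2 = of_int l * d"
    unfolding lat_def by blast
  thus "v - w \<in> lat a x d"
    unfolding lat_def by (intro CollectI exI[of _ "i - k"] exI[of _ "j - l"]) (simp add: algebra_simps)
qed

text \<open>The two basis vectors of the smaller lattice determine its position: \<open>t\<close> and \<open>n\<close> are the
  diagonal entries of the base change matrix, so that \<open>t n\<close> will be the index.\<close>

lemma lat_subset_iff:
  assumes "a > 0" "d > 0" "a' > 0" "d' > 0"
  shows "lat a' x' d' \<subseteq> lat a x d \<longleftrightarrow>
           (\<exists>t n l :: int. t > 0 \<and> n > 0 \<and> a' = of_int t * a \<and> d' = of_int n * d \<and>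
              x' = of_int n * x + of_int l * a)"
proof
  assume sub: "lat a' x' d' \<subseteq> lat a x d"
  have "vector [a', 0] \<in> lat a' x' d'"
    unfolding vector_in_lat_iff by (intro exI[of _ 1] exI[of _ 0]) simp
  hence "vector [a', 0] \<in> lat a x d" using sub by (rule subsetD[rotated])
  then obtain t j :: int where t: "a' = of_int t * a + of_int j * x" "0 = of_int j * d"
    unfolding vector_in_lat_iff by blast
  have "vector [x', d'] \<in> lat a' x' d'"
    unfolding vector_in_lat_iff by (intro exI[of _ 0] exI[of _ 1]) simp
  hence "vector [x', d'] \<in> lat a x d" using sub by (rule subsetD[rotated])
  then obtain l n :: int where n: "x' = of_int l * a + of_int n * x" "d' = of_int n * d"
    unfolding vector_in_lat_iff by blast
  have "j = 0" using t(2) assms by simp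
  hence a': "a' = of_int t * a" using t by simp
  have "t > 0" using a' assms by (simp add: zero_less_mult_iff)
  moreover have "n > 0" using n(2) assms by (simp add: zero_less_mult_iff)
  ultimately show "\<exists>t n l :: int. t > 0 \<and> n > 0 \<and> a' = of_int t * a \<and> d' = of_int n * d \<and>
              x' = of_int n * x + of_int l * a"
    using a' n by (intro exI[of _ t] exI[of _ n] exI[of _ l]) simp
next
  assume "\<exists>t n l :: int. t > 0 \<and> n > 0 \<and> a' = of_int t * a \<and> d' = of_int n * d \<and>
              x' = of_int n * x + of_int l * a"
  then obtain t n l :: int where *: "a' = of_int t * a" "d' = of_int n * d"
    "x' = of_int n * x + of_int l * a" by blast
  show "lat a' x' d' \<subseteq> lat a x d"
  proof
    fix v assume "v \<in> lat a' x' d'"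
    then obtain i j :: int where "v $ 1 = of_int i * a' + of_int j * x'" "v $ 2 = of_int j * d'"
      unfolding lat_def by blast
    thus "v \<in> lat a x d"
      unfolding lat_def
      by (intro CollectI exI[of _ "i * t + j * l"] exI[of _ "j * n"]) (simp add: * algebra_simps)
  qed
qed

lemma lat_eqI:
  assumes "x' - x = of_int l * a"
  shows   "lat a x d = lat a x' d"
proof -
  have "lat a x' d \<subseteq> lat a x d" if "x' - x = of_int l * a" for x x' l
  proof
    fix v assume "v \<in> lat a x' d"
    then obtain i j :: int where "v $ 1 = of_int i * a + of_int j * x'" "v $ 2 = of_int j * d"
      unfolding lat_def by blast
    moreover have "x' = x + of_int l * a" using that by (simp add: algebra_simps)
    ultimately show "v \<in> lat a x d"
      unfolding lat_def
      by (intro CollectI exI[of _ "i + j * l"] exI[of _ j]) (simp add: algebra_simps)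
  qed
  note sub = this
  have "x - x' = of_int (- l) * a" using assms by simp
  from sub[OF assms] sub[OF this] show ?thesis by blast
qed

lemma lat_eqD:
  assumes "lat a x d = lat a' x' d'" "a > 0" "d > 0" "a' > 0" "d' > 0"
  shows   "a' = a" "d' = d" "\<exists>l :: int. x' - x = of_int l * a"
proof -
  obtain t n l :: int where 1: "t > 0" "n > 0" "a' = of_int t * a" "d' = of_int n * d"
    "x' = of_int n * x + of_int l * a"
    using lat_subset_iff[of a d a' d' x' x] assms by auto
  obtain t' n' l' :: int where 2: "t' > 0" "n' > 0" "a = of_int t' * a'" "d = of_int n' * d'"
    using lat_subset_iff[of a' d' a d x x'] assms by auto
  have "of_int (t' * t) = (1 :: rat)" "of_int (n' * n) = (1 :: rat)"
    using 1 2 assms by (auto simp: field_simps)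
  hence "t' * t = 1" "n' * n = 1" by (simp_all only: of_int_eq_1_iff)
  hence "t = 1" "n = 1" using 1 2 by (auto simp: zmult_eq_1_iff)
  thus "a' = a" "d' = d" "\<exists>l :: int. x' - x = of_int l * a"
    using 1 by (auto intro: exI[of _ l])
qed

lemma add_subgroupD:
  assumes "add_subgroup K"
  shows   "0 \<in> K" "\<And>x y. x \<in> K \<Longrightarrow> y \<in> K \<Longrightarrow> x - y \<in> K"
    and   "\<And>x. x \<in> K \<Longrightarrow> - x \<in> K" "\<And>x y. x \<in> K \<Longrightarrow> y \<in> K \<Longrightarrow> x + y \<in> K"
proof -
  show zero: "0 \<in> K" and diff: "\<And>x y. x \<in> K \<Longrightarrow> y \<in> K \<Longrightarrow> x - y \<in> K"
    using assms by (auto simp: add_subgroup_def)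
  show neg: "- x \<in> K" if "x \<in> K" for x using diff[OF zero that] by simp
  show "x + y \<in> K" if "x \<in> K" "y \<in> K" for x y using diff[OF that(1) neg[OF that(2)]] by simp
qed

lemma coset_eq_iff:
  assumes "add_subgroup K"
  shows   "v +o K = w +o K \<longleftrightarrow> v - w \<in> K"
proof
  note K = add_subgroupD(1,2)[OF assms]
    and neg = add_subgroupD(3)[OF assms] and add = add_subgroupD(4)[OF assms]
  {
    assume "v +o K = w +o K"
    moreover have "v \<in> v +o K" using K(1) by (auto simp: elt_set_plus_def intro!: bexI[of _ 0])
    ultimately obtain k where "k \<in> K" "v = w + k" by (auto simp: elt_set_plus_def)
    thus "v - w \<in> K" by simp
  }
  have sub: "v +o K \<subseteq> w +o K" if "v - w \<in> K" for v w
  proof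
    fix z assume "z \<in> v +o K"
    then obtain k where "k \<in> K" "z = v + k" by (auto simp: elt_set_plus_def)
    hence "z = w + ((v - w) + k)" "(v - w) + k \<in> K" using add that by auto
    thus "z \<in> w +o K" unfolding elt_set_plus_def by blast
  qed
  assume "v - w \<in> K"
  moreover from neg[OF this] have "w - v \<in> K" by simp
  ultimately show "v +o K = w +o K" using sub by blast
qed

text \<open>Coset representatives are the combinations of the basis vectors with coefficients in
  \<open>{0..<t} \<times> {0..<n}\<close>: the second coefficient is reduced modulo \<open>n\<close> first, at the price of a shift by
  a multiple of \<open>l\<close> in the first one, which is then reduced modulo \<open>t\<close>.\<close>

lemma lat_index_lat:
  assumes pos: "a > 0" "d > 0" and t: "t > 0" and n: "n > 0"
    and K: "K = lat (of_int t * a) (of_int n * x + of_int l * a) (of_int n * d)"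
  shows   "finite (cosets (lat a x d) K)" "int (lat_index (lat a x d) K) = t * n"
proof -
  define w :: "int \<times> int \<Rightarrow> rat ^ 2" where
    "w = (\<lambda>(i, j). vector [of_int i * a + of_int j * x, of_int j * d])"
  have wK: "w (i, j) \<in> K \<longleftrightarrow> (\<exists>p q. j = q * n \<and> i = p * t + q * l)" for i j
  proof -
    have "w (i, j) \<in> K \<longleftrightarrow> (\<exists>p q :: int. of_int i * a + of_int j * x =
        of_int p * (of_int t * a) + of_int q * (of_int n * x + of_int l * a) \<and>
        of_int j * d = of_int q * (of_int n * d))"
      unfolding w_def K prod.case vector_in_lat_iff ..
    also have "\<dots> \<longleftrightarrow> (\<exists>p q. j = q * n \<and> i = p * t + q * l)"
    proof (intro ex_cong1)
      fix p q :: int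
      have 1: "of_int j * d = of_int q * (of_int n * d) \<longleftrightarrow> j = q * n"
      proof -
        have "of_int j * d = of_int q * (of_int n * d) \<longleftrightarrow> of_int j * d = of_int (q * n) * d" by simp
        also have "\<dots> \<longleftrightarrow> j = q * n" using pos by (simp only: mult_cancel_right of_int_eq_iff) auto
        finally show ?thesis .
      qed
      have 2: "of_int i * a + of_int (q * n) * x =
        of_int p * (of_int t * a) + of_int q * (of_int n * x + of_int l * a) \<longleftrightarrow> i = p * t + q * l"
      proof -
        have "of_int i * a + of_int (q * n) * x =
            of_int p * (of_int t * a) + of_int q * (of_int n * x + of_int l * a) \<longleftrightarrow>
            of_int i * a = of_int (p * t + q * l) * a"
          by (simp add: algebra_simps)
        also have "\<dots> \<longleftrightarrow> i = p * t + q * l"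
          using pos by (simp only: mult_cancel_right of_int_eq_iff) auto
        finally show ?thesis .
      qed
      show "(of_int i * a + of_int j * x =
        of_int p * (of_int t * a) + of_int q * (of_int n * x + of_int l * a) \<and>
        of_int j * d = of_int q * (of_int n * d)) \<longleftrightarrow> (j = q * n \<and> i = p * t + q * l)"
        using 1 2 by auto
    qed
    finally show ?thesis .
  qed
  have sub: "add_subgroup K" unfolding K by (rule add_subgroup_lat)
  have wdiff: "w (i, j) - w (i', j') = w (i - i', j - j')" for i j i' j'
    by (simp add: w_def vec2_eq_iff algebra_simps)
  have coset: "w (i, j) +o K = w (i', j') +o K \<longleftrightarrow> (\<exists>p q. j - j' = q * n \<and> i - i' = p * t + q * l)"
    for i j i' j'
    unfolding coset_eq_iff[OF sub] wdiff wK ..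
  have "bij_betw (\<lambda>z. w z +o K) ({0..<t} \<times> {0..<n}) (cosets (lat a x d) K)"
    unfolding bij_betw_def
  proof
    show "inj_on (\<lambda>z. w z +o K) ({0..<t} \<times> {0..<n})"
    proof (rule inj_onI, clarify)
      fix i j i' j'
      assume *: "i \<in> {0..<t}" "j \<in> {0..<n}" "i' \<in> {0..<t}" "j' \<in> {0..<n}"
        "w (i, j) +o K = w (i', j') +o K"
      then obtain p q where pq: "j - j' = q * n" "i - i' = p * t + q * l"
        unfolding coset by blast
      have "j mod n = j' mod n" using pq(1) by (simp add: mod_eq_dvd_iff)
      hence j: "j = j'" using * by simp
      hence "q = 0" using pq(1) n by simp
      hence "i mod t = i' mod t" using pq(2) by (simp add: mod_eq_dvd_iff)
      hence "i = i'" using * by simp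
      thus "i = i' \<and> j = j'" using j by simp
    qed
    have w_in: "w z \<in> lat a x d" for z
      unfolding w_def case_prod_beta vector_in_lat_iff by blast
    show "(\<lambda>z. w z +o K) ` ({0..<t} \<times> {0..<n}) = cosets (lat a x d) K"
    proof (intro subset_antisym subsetI)
      fix C assume "C \<in> cosets (lat a x d) K"
      then obtain v where v: "v \<in> lat a x d" "C = v +o K" by (auto simp: cosets_def)
      then obtain i j :: int where "v $ 1 = of_int i * a + of_int j * x" "v $ 2 = of_int j * d"
        unfolding lat_def by blast
      hence vw: "v = w (i, j)" by (simp add: w_def vec2_eq_iff)
      let ?j = "j mod n" and ?i = "(i - (j div n) * l) mod t"
      have "j - ?j = (j div n) * n" by (simp add: minus_mod_eq_div_mult)
      moreover have "i - ?i = ((i - (j div n) * l) div t) * t + (j div n) * l"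
        using minus_mod_eq_div_mult[of "i - (j div n) * l" t] by linarith
      ultimately have "w (i, j) +o K = w (?i, ?j) +o K" unfolding coset by blast
      moreover have "(?i, ?j) \<in> {0..<t} \<times> {0..<n}" using t n by simp
      ultimately show "C \<in> (\<lambda>z. w z +o K) ` ({0..<t} \<times> {0..<n})" using v vw by blast
    qed (use w_in in \<open>auto simp: cosets_def\<close>)
  qed
  from bij_betw_finite[OF this] bij_betw_same_card[OF this]
  have "finite (cosets (lat a x d) K)" "lat_index (lat a x d) K = nat t * nat n"
    by (simp_all add: lat_index_def card_cartesian_product)
  thus "finite (cosets (lat a x d) K)" "int (lat_index (lat a x d) K) = t * n"
    using t n by simp_all
qed

lemma add_subgroup_int_scale:
  assumes "add_subgroup (K :: (rat ^ 2) set)" "v \<in> K"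
  shows   "of_int k *s v \<in> K"
proof -
  note K = add_subgroupD(1,2)[OF assms(1)]
    and neg = add_subgroupD(3)[OF assms(1)] and add = add_subgroupD(4)[OF assms(1)]
  have nat: "of_nat m *s v \<in> K" for m
  proof (induction m)
    case (Suc m)
    have *: "of_nat (Suc m) *s v = of_nat m *s v + v"
      by (simp add: vec2_eq_iff algebra_simps)
    show ?case unfolding * by (rule add[OF Suc assms(2)])
  qed (use K(1) in simp)
  show ?thesis
  proof (cases "k \<ge> 0")
    case True
    thus ?thesis using nat[of "nat k"] by simp
  next
    case False
    have "of_int k *s v = - (of_nat (nat (- k)) *s v)" using False by (simp add: vec2_eq_iff)
    thus ?thesis using neg[OF nat[of "nat (- k)"]] by simp
  qed
qed

text \<open>By the pigeonhole principle two multiples of \<open>v\<close> lie in the same coset.\<close>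

lemma finite_cosets_torsion:
  assumes L: "add_subgroup (L :: (rat ^ 2) set)" and K: "add_subgroup K"
    and fin: "finite (cosets L K)" and v: "v \<in> L"
  obtains k :: int where "k > 0" "of_int k *s v \<in> K"
proof -
  have "(of_int (int m) *s v) +o K \<in> cosets L K" for m :: nat
    unfolding cosets_def using add_subgroup_int_scale[OF L v] by (rule imageI)
  hence "range (\<lambda>m :: nat. (of_int (int m) *s v) +o K) \<subseteq> cosets L K" by blast
  hence "finite (range (\<lambda>m :: nat. (of_int (int m) *s v) +o K))"
    using fin by (rule finite_subset)
  hence "\<not> inj (\<lambda>m :: nat. (of_int (int m) *s v) +o K)"
    by (metis finite_imageD infinite_UNIV_nat)
  then obtain m n :: nat where mn: "m < n" "(of_int (int n) *s v) +o K = (of_int (int m) *s v) +o K"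
  proof -
    obtain m n :: nat where "m \<noteq> n" "(of_int (int n) *s v) +o K = (of_int (int m) *s v) +o K"
      using \<open>\<not> inj _\<close> unfolding inj_def by metis
    thus ?thesis using that by (cases "m < n") (auto simp: not_less_iff_gr_or_eq)
  qed
  have "of_int (int n) *s v - of_int (int m) *s v \<in> K"
    using mn(2) by (simp only: coset_eq_iff[OF K])
  also have "of_int (int n) *s v - of_int (int m) *s v = of_int (int n - int m) *s v"
    by (simp add: vec2_eq_iff algebra_simps)
  finally show ?thesis using mn(1) that[of "int n - int m"] by simp
qed

lemma add_subgroup_int_cyclic:
  assumes S: "add_subgroup (S :: int set)" and p: "p \<in> S" "p > 0"
  obtains g where "g > 0" "S = range (\<lambda>i. i * g)"
proof -
  note K = add_subgroupD(1,2)[OF S]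
    and neg = add_subgroupD(3)[OF S] and add = add_subgroupD(4)[OF S]
  have nat: "int m * x \<in> S" if "x \<in> S" for m x
  proof (induction m)
    case (Suc m)
    from add[OF Suc that] show ?case by (simp add: algebra_simps)
  qed (use K(1) in simp)
  have mult: "k * x \<in> S" if "x \<in> S" for k x
  proof (cases "k \<ge> 0")
    case True
    thus ?thesis using nat[OF that, of "nat k"] by simp
  next
    case False
    thus ?thesis using neg[OF nat[OF that, of "nat (- k)"]] by simp
  qed
  define m where "m = (LEAST m. m > 0 \<and> int m \<in> S)"
  have ex: "nat p > 0 \<and> int (nat p) \<in> S" using p by simp
  have m: "m > 0" "int m \<in> S" using LeastI[of "\<lambda>m. m > 0 \<and> int m \<in> S", OF ex] by (auto simp: m_def)
  have "S = range (\<lambda>i. i * int m)"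
  proof (intro subset_antisym subsetI)
    fix x assume x: "x \<in> S"
    have "x - (x div int m) * int m \<in> S" using K(2)[OF x mult[OF m(2)]] .
    hence mod: "x mod int m \<in> S" by (simp add: minus_div_mult_eq_mod)
    have "x mod int m = 0"
    proof (rule ccontr)
      assume "x mod int m \<noteq> 0"
      moreover have "0 \<le> x mod int m" "x mod int m < int m" using m(1) by simp_all
      ultimately have "nat (x mod int m) > 0 \<and> int (nat (x mod int m)) \<in> S" "nat (x mod int m) < m"
        using mod by simp_all
      thus False using not_less_Least[of _ "\<lambda>m. m > 0 \<and> int m \<in> S"] unfolding m_def by blast
    qed
    hence "x = (x div int m) * int m" using div_mult_mod_eq[of x "int m"] by linarith
    thus "x \<in> range (\<lambda>i. i * int m)" by blast
  next
    fix x assume "x \<in> range (\<lambda>i. i * int m)"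
    thus "x \<in> S" using mult[OF m(2)] by blast
  qed
  moreover have "int m > 0" using m(1) by simp
  ultimately show ?thesis using that by blast
qed

text \<open>The triangular basis consists of a generator of the intersection with the first axis and of a
  vector above a generator of the projection to the second axis; the two multiples of the standard
  basis vectors ensure that both groups are nonzero.\<close>

lemma add_subgroup_hyp_lat:
  assumes K: "add_subgroup K" "K \<subseteq> hyp"
    and p: "p > 0" "vector [of_int p, 0] \<in> K" and q: "q > 0" "vector [0, of_int q] \<in> K"
  obtains a x d where "a > 0" "d > 0" "K = lat a x d"
proof -
  note K' = add_subgroupD(1,2)[OF K(1)]
    and neg = add_subgroupD(3)[OF K(1)] and add = add_subgroupD(4)[OF K(1)]
  have zero: "vector [0, 0] = (0 :: rat ^ 2)" by (simp add: vec2_eq_iff)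
  have diff: "vector [x - y, z - w] = (vector [x, z] - vector [y, w] :: rat ^ 2)" for x y z w
    by (simp add: vec2_eq_iff)
  define S1 where "S1 = {i :: int. vector [of_int i, 0] \<in> K}"
  define S2 where "S2 = {j :: int. \<exists>i :: int. vector [of_int i, of_int j] \<in> K}"
  have "add_subgroup S1"
    unfolding add_subgroup_def
  proof (intro conjI ballI)
    show "0 \<in> S1" using K'(1) zero by (simp add: S1_def)
    fix i i' assume "i \<in> S1" "i' \<in> S1"
    hence "vector [of_int i, 0] - vector [of_int i', 0] \<in> K"
      unfolding S1_def by (intro K'(2)) simp_all
    thus "i - i' \<in> S1" unfolding S1_def diff[symmetric] by simp
  qed
  then obtain a where a: "a > 0" "S1 = range (\<lambda>i. i * a)"
    using add_subgroup_int_cyclic[OF _ _ p(1), of S1] p(2) unfolding S1_def by blast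
  have "add_subgroup S2"
    unfolding add_subgroup_def
  proof (intro conjI ballI)
    have "vector [of_int 0, of_int 0] \<in> K" using K'(1) zero by simp
    thus "0 \<in> S2" unfolding S2_def by blast
    fix j j' assume "j \<in> S2" "j' \<in> S2"
    then obtain i i' where "vector [of_int i, of_int j] \<in> K" "vector [of_int i', of_int j'] \<in> K"
      by (auto simp: S2_def)
    from K'(2)[OF this] have "vector [of_int (i - i'), of_int (j - j')] \<in> K"
      by (simp add: diff)
    thus "j - j' \<in> S2" unfolding S2_def by blast
  qed
  moreover have "q \<in> S2" using q unfolding S2_def by (intro CollectI exI[of _ 0]) simp
  ultimately obtain d where d: "d > 0" "S2 = range (\<lambda>i. i * d)"
    using add_subgroup_int_cyclic[OF _ _ q(1)] by blast
  have "d \<in> S2" using d(2) by (simp add: range_eqI[of _ _ 1])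
  then obtain x :: int where x: "vector [of_int x, of_int d] \<in> K" unfolding S2_def by blast
  have aK: "vector [of_int a, 0] \<in> K"
  proof -
    have "a \<in> S1" using a(2) by (simp add: range_eqI[of _ _ 1])
    thus ?thesis by (simp add: S1_def)
  qed
  have "K = lat (of_int a) (of_int x) (of_int d)"
  proof (intro subset_antisym subsetI)
    fix v assume v: "v \<in> K"
    hence "v $ 1 \<in> \<int>" "v $ 2 \<in> \<int>" using K(2) by (auto simp: hyp_def)
    then obtain i j :: int where ij: "v $ 1 = of_int i" "v $ 2 = of_int j" by (elim Ints_cases)
    have v_eq: "v = vector [of_int i, of_int j]" using ij by (simp add: vec2_eq_iff)
    have "j \<in> S2" using v unfolding v_eq S2_def by blast
    then obtain k where k: "j = k * d" using d(2) by auto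
    have "v - of_int k *s vector [of_int x, of_int d] \<in> K"
      using K'(2)[OF v add_subgroup_int_scale[OF K(1) x]] .
    also have "v - of_int k *s vector [of_int x, of_int d] = vector [of_int (i - k * x), 0]"
      by (simp add: vec2_eq_iff ij k)
    finally have "i - k * x \<in> S1" by (simp add: S1_def)
    then obtain l where l: "i - k * x = l * a" using a(2) by auto
    hence "i = l * a + k * x" by simp
    thus "v \<in> lat (of_int a) (of_int x) (of_int d)"
      unfolding lat_def by (intro CollectI exI[of _ l] exI[of _ k]) (simp add: ij k)
  next
    fix v assume "v \<in> lat (of_int a) (of_int x) (of_int d)"
    then obtain i j :: int where ij: "v $ 1 = of_int i * of_int a + of_int j * of_int x"
      "v $ 2 = of_int j * of_int d" unfolding lat_def by blast
    have "v = of_int i *s vector [of_int a, 0] + of_int j *s vector [of_int x, of_int d]"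
      by (simp add: vec2_eq_iff ij)
    thus "v \<in> K"
      using add[OF add_subgroup_int_scale[OF K(1) aK, of i] add_subgroup_int_scale[OF K(1) x, of j]]
      by (simp only:)
  qed
  thus ?thesis using a d that[of "of_int a" "of_int d" "of_int x"] by simp
qed

lemma add_subgroup_hyp: "add_subgroup hyp"
  unfolding hyp_eq_lat by (rule add_subgroup_lat)

lemma sublattice_is_lat:
  assumes L: "sublattice L hyp" and K: "sublattice K L"
  obtains a x d where "a > 0" "d > 0" "K = lat a x d"
proof -
  have sub: "add_subgroup L" "finite (cosets hyp L)" "add_subgroup K" "finite (cosets L K)"
    and subset: "K \<subseteq> hyp" using L K unfolding sublattice_def by blast+
  have tors: "\<exists>k :: int. k > 0 \<and> of_int k *s v \<in> K" if v: "v \<in> hyp" for v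
  proof -
    obtain k1 :: int where k1: "k1 > 0" "of_int k1 *s v \<in> L"
      by (rule finite_cosets_torsion[OF add_subgroup_hyp sub(1,2) v])
    obtain k2 :: int where k2: "k2 > 0" "of_int k2 *s (of_int k1 *s v) \<in> K"
      by (rule finite_cosets_torsion[OF sub(1,3,4) k1(2)])
    have "of_int (k2 * k1) *s v = of_int k2 *s (of_int k1 *s v)"
      by (simp add: vec2_eq_iff)
    hence "of_int (k2 * k1) *s v \<in> K" using k2(2) by (simp only:)
    moreover have "k2 * k1 > 0" using k1 k2 by simp
    ultimately show ?thesis by blast
  qed
  have e: "vector [1, 0] \<in> hyp" "vector [0, 1] \<in> hyp" by (simp_all add: hyp_def)
  obtain p :: int where p: "p > 0" "of_int p *s vector [1, 0] \<in> K" using tors[OF e(1)] by blast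
  obtain q :: int where q: "q > 0" "of_int q *s vector [0, 1] \<in> K" using tors[OF e(2)] by blast
  have "of_int p *s vector [1, 0] = (vector [of_int p, 0] :: rat ^ 2)"
    "of_int q *s vector [0, 1] = (vector [0, of_int q] :: rat ^ 2)" by (simp_all add: vec2_eq_iff)
  hence "vector [of_int p, 0] \<in> K" "vector [0, of_int q] \<in> K" using p(2) q(2) by (simp_all only:)
  thus ?thesis using add_subgroup_hyp_lat[OF sub(3) subset p(1) _ q(1)] that by blast
qed

definition hscale :: "rat \<Rightarrow> rat ^ 2 \<Rightarrow> rat ^ 2" where
  "hscale c v = vector [c * v $ 1, v $ 2 / c]"

lemma hscale_nth [simp]: "hscale c v $ 1 = c * v $ 1" "hscale c v $ 2 = v $ 2 / c"
  by (simp_all add: hscale_def)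

lemma matrix_vector_nth:
  fixes \<sigma> :: "rat ^ 2 ^ 2"
  shows "(\<sigma> *v x) $ 1 = \<sigma> $ 1 $ 1 * x $ 1 + \<sigma> $ 1 $ 2 * x $ 2"
    and "(\<sigma> *v x) $ 2 = \<sigma> $ 2 $ 1 * x $ 1 + \<sigma> $ 2 $ 2 * x $ 2"
  by (simp_all add: matrix_vector_mult_def sum_2)

lemma bilin_alt: "bilin x y = (x $ 1 * y $ 2 + x $ 2 * y $ 1) / 2"
  by (simp add: bilin_def Q_def field_simps)

text \<open>An isometry permutes the two isotropic lines, and determinant \<open>1\<close> excludes the swap.\<close>

lemma proper_orth_group_iff:
  "\<sigma> \<in> proper_orth_group \<longleftrightarrow> (\<exists>c. c \<noteq> 0 \<and> (\<lambda>x. \<sigma> *v x) = hscale c)"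
proof
  assume "\<sigma> \<in> proper_orth_group"
  hence det: "\<sigma> $ 1 $ 1 * \<sigma> $ 2 $ 2 - \<sigma> $ 1 $ 2 * \<sigma> $ 2 $ 1 = 1"
    and b: "\<And>x y. bilin (\<sigma> *v x) (\<sigma> *v y) = bilin x y"
    by (auto simp: proper_orth_group_def orth_group_def det_2)
  have 1: "\<sigma> $ 1 $ 1 * \<sigma> $ 2 $ 1 = 0"
    using b[of "vector [1, 0]" "vector [1, 0]"] by (auto simp: bilin_alt matrix_vector_nth)
  have 2: "\<sigma> $ 1 $ 2 * \<sigma> $ 2 $ 2 = 0"
    using b[of "vector [0, 1]" "vector [0, 1]"] by (auto simp: bilin_alt matrix_vector_nth)
  have 3: "\<sigma> $ 1 $ 1 * \<sigma> $ 2 $ 2 + \<sigma> $ 2 $ 1 * \<sigma> $ 1 $ 2 = 1"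
    using b[of "vector [1, 0]" "vector [0, 1]"] by (auto simp: bilin_alt matrix_vector_nth)
  have 4: "\<sigma> $ 1 $ 1 * \<sigma> $ 2 $ 2 = 1" using det 3 by (simp add: mult.commute)
  hence c: "\<sigma> $ 1 $ 1 \<noteq> 0" "\<sigma> $ 2 $ 2 \<noteq> 0" by auto
  hence off: "\<sigma> $ 2 $ 1 = 0" "\<sigma> $ 1 $ 2 = 0" using 1 2 by auto
  have "\<sigma> $ 2 $ 2 = 1 / \<sigma> $ 1 $ 1" using 4 c by (simp add: field_simps)
  hence "(\<lambda>x. \<sigma> *v x) = hscale (\<sigma> $ 1 $ 1)"
    by (intro ext) (simp add: vec2_eq_iff matrix_vector_nth off)
  thus "\<exists>c. c \<noteq> 0 \<and> (\<lambda>x. \<sigma> *v x) = hscale c" using c by blast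
next
  assume "\<exists>c. c \<noteq> 0 \<and> (\<lambda>x. \<sigma> *v x) = hscale c"
  then obtain c where c: "c \<noteq> 0" "\<And>x. \<sigma> *v x = hscale c x" by metis
  have "\<sigma> $ 1 $ 1 = c" "\<sigma> $ 2 $ 1 = 0"
    using c(2)[of "vector [1, 0]"] by (simp_all add: vec2_eq_iff matrix_vector_nth)
  moreover have "\<sigma> $ 1 $ 2 = 0" "\<sigma> $ 2 $ 2 = 1 / c"
    using c(2)[of "vector [0, 1]"] by (simp_all add: vec2_eq_iff matrix_vector_nth)
  ultimately have "det \<sigma> = 1" using c(1) by (simp add: det_2)
  moreover have "bilin (\<sigma> *v x) (\<sigma> *v y) = bilin x y" for x y
    using c(1) by (simp add: bilin_alt c(2))
  ultimately show "\<sigma> \<in> proper_orth_group"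
    by (simp add: proper_orth_group_def orth_group_def invertible_det_nz)
qed

lemma properly_isometric_iff_hscale:
  "properly_isometric K K' \<longleftrightarrow> (\<exists>c. c \<noteq> 0 \<and> hscale c ` K = K')"
proof
  assume "properly_isometric K K'"
  then obtain \<sigma> where \<sigma>: "\<sigma> \<in> proper_orth_group" "(\<lambda>x. \<sigma> *v x) ` K = K'"
    unfolding properly_isometric_def by blast
  then obtain c where "c \<noteq> 0" "(\<lambda>x. \<sigma> *v x) = hscale c"
    using proper_orth_group_iff by blast
  thus "\<exists>c. c \<noteq> 0 \<and> hscale c ` K = K'" using \<sigma>(2) by auto
next
  assume "\<exists>c. c \<noteq> 0 \<and> hscale c ` K = K'"
  then obtain c where c: "c \<noteq> 0" "hscale c ` K = K'" by blast
  define \<sigma> :: "rat ^ 2 ^ 2" where "\<sigma> = vector [vector [c, 0], vector [0, 1 / c]]"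
  have "(\<lambda>x. \<sigma> *v x) = hscale c"
    by (intro ext) (simp add: vec2_eq_iff matrix_vector_nth \<sigma>_def)
  thus "properly_isometric K K'"
    using c unfolding properly_isometric_def by (intro bexI[of _ \<sigma>]) (auto simp: proper_orth_group_iff)
qed

lemma equiv_properly_isometric: "equiv UNIV {(K, K'). properly_isometric K K'}"
proof (rule equivI)
  have hh: "hscale c (hscale c' v) = hscale (c * c') v" for c c' v
    by (simp add: vec2_eq_iff)
  have h1: "hscale 1 v = v" for v by (simp add: vec2_eq_iff)
  show "refl {(K, K'). properly_isometric K K'}"
  proof (rule refl_onI)
    fix K :: "(rat ^ 2) set"
    have "hscale 1 ` K = K" by (simp add: h1)
    hence "\<exists>c. c \<noteq> 0 \<and> hscale c ` K = K" by (intro exI[of _ 1]) simp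
    thus "(K, K) \<in> {(K, K'). properly_isometric K K'}"
      by (simp add: properly_isometric_iff_hscale)
  qed
  show "sym {(K, K'). properly_isometric K K'}"
  proof (rule symI, clarify)
    fix K K' assume "properly_isometric K K'"
    then obtain c where c: "c \<noteq> 0" "K' = hscale c ` K" unfolding properly_isometric_iff_hscale by blast
    have "hscale (1 / c) ` K' = K" using c(1) by (simp add: c(2) image_image hh h1)
    thus "properly_isometric K' K"
      unfolding properly_isometric_iff_hscale using c(1) by (intro exI[of _ "1 / c"]) simp
  qed
  show "trans {(K, K'). properly_isometric K K'}"
  proof (rule transI, clarify)
    fix K1 K2 K3 assume "properly_isometric K1 K2" "properly_isometric K2 K3"
    then obtain c c' where c: "c \<noteq> 0" "K2 = hscale c ` K1" "c' \<noteq> 0" "K3 = hscale c' ` K2"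
      unfolding properly_isometric_iff_hscale by blast
    have "hscale (c' * c) ` K1 = K3" by (simp add: c image_image hh)
    thus "properly_isometric K1 K3"
      unfolding properly_isometric_iff_hscale using c by (intro exI[of _ "c' * c"]) simp
  qed
qed auto

text \<open>For negative \<open>c\<close> the right-hand side has negative parameters; \<open>lat_minus\<close> makes them positive.\<close>

lemma hscale_lat:
  assumes "c \<noteq> 0"
  shows   "hscale c ` lat a x d = lat (c * a) (c * x) (d / c)"
proof (intro subset_antisym subsetI)
  fix v assume "v \<in> lat (c * a) (c * x) (d / c)"
  then obtain i j :: int where "v $ 1 = of_int i * (c * a) + of_int j * (c * x)"
    "v $ 2 = of_int j * (d / c)" unfolding lat_def by blast
  hence "v = hscale c (vector [of_int i * a + of_int j * x, of_int j * d])"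
    by (simp add: vec2_eq_iff algebra_simps)
  moreover have "vector [of_int i * a + of_int j * x, of_int j * d] \<in> lat a x d"
    unfolding vector_in_lat_iff by blast
  ultimately show "v \<in> hscale c ` lat a x d" by blast
next
  fix v assume "v \<in> hscale c ` lat a x d"
  then obtain w where w: "w \<in> lat a x d" "v = hscale c w" by blast
  then obtain i j :: int where "w $ 1 = of_int i * a + of_int j * x" "w $ 2 = of_int j * d"
    unfolding lat_def by blast
  thus "v \<in> lat (c * a) (c * x) (d / c)"
    unfolding lat_def w(2) by (intro CollectI exI[of _ i] exI[of _ j]) (simp add: algebra_simps)
qed

lemma lat_minus: "lat (- a) (- x) (- d) = lat a x d"
proof -
  have "lat (- a) (- x) (- d) \<subseteq> lat a x d" for a x d
  proof
    fix v assume "v \<in> lat (- a) (- x) (- d)"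
    then obtain i j :: int where "v $ 1 = of_int i * (- a) + of_int j * (- x)"
      "v $ 2 = of_int j * (- d)" unfolding lat_def by blast
    thus "v \<in> lat a x d"
      unfolding lat_def by (intro CollectI exI[of _ "- i"] exI[of _ "- j"]) simp
  qed
  from this[of a x d] this[of "- a" "- x" "- d"] show ?thesis by auto
qed

text \<open>The covolume and the offset modulo \<open>1\<close> are a complete system of invariants: scaling by
  \<open>c = a' / a\<close> makes the first diagonal entries agree, the covolume then forces the second ones to
  agree, and the last parameter matters only modulo the first.\<close>

lemma properly_isometric_lat_iff:
  assumes "a > 0" "d > 0" "a' > 0" "d' > 0"
  shows "properly_isometric (lat a x d) (lat a' x' d') \<longleftrightarrow> a * d = a' * d' \<and> x' / a' - x / a \<in> \<int>"
proof
  assume "properly_isometric (lat a x d) (lat a' x' d')"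
  then obtain c where c: "c \<noteq> 0" "lat (c * a) (c * x) (d / c) = lat a' x' d'"
    unfolding properly_isometric_iff_hscale using hscale_lat by metis
  \<comment> \<open>multiplication by \<open>-1\<close> preserves every lattice, so the sign of \<open>c\<close> is irrelevant\<close>
  define e where "e = \<bar>c\<bar>"
  have e: "e > 0" using c by (simp add: e_def)
  have "lat (e * a) (e * x) (d / e) = lat a' x' d'"
    using c lat_minus[of "c * a" "c * x" "d / c"] by (auto simp: e_def abs_if)
  from lat_eqD[OF this] obtain l :: int
    where l: "a' = e * a" "d' = d / e" "x' - e * x = of_int l * (e * a)"
    using assms e by auto
  have "x' = e * x + of_int l * (e * a)" using l(3) by simp
  hence "x' / a' - x / a = of_int l" using l(1) e assms by (simp add: field_simps)
  thus "a * d = a' * d' \<and> x' / a' - x / a \<in> \<int>" using l e by simp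
next
  assume *: "a * d = a' * d' \<and> x' / a' - x / a \<in> \<int>"
  then obtain l where l: "x' / a' - x / a = of_int l" by (auto elim: Ints_cases)
  define c where "c = a' / a"
  have c: "c \<noteq> 0" "c * a = a'" "d / c = d'" using assms * by (auto simp: c_def field_simps)
  have "x' - c * x = of_int l * a'" using l assms by (simp add: c_def field_simps)
  from lat_eqI[OF this] have "lat a' (c * x) d' = lat a' x' d'" .
  hence "hscale c ` lat a x d = lat a' x' d'" using hscale_lat[OF c(1)] c by simp
  thus "properly_isometric (lat a x d) (lat a' x' d')"
    unfolding properly_isometric_iff_hscale using c by blast
qed

text \<open>Every class of sublattices of index \<open>m\<close> is represented by the lattice \<open>lat 1 r D\<close>, where \<open>D\<close> is
  the common covolume and \<open>0 \<le> r < 1\<close>. This representative need not lie in the given lattice; it is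
  isometric to a sublattice exactly if \<open>r\<close> satisfies the condition coming from \<open>lat_subset_iff\<close>.\<close>

lemma num_proper_classes_lat:
  assumes L: "sublattice (lat a x d) hyp" and pos: "a > 0" "d > 0" and m: "m > 0"
  shows "num_proper_classes (lat a x d) m =
    card {r :: rat. 0 \<le> r \<and> r < 1 \<and> (\<exists>t n. t * n = m \<and> of_nat t * r - of_nat n * (x / a) \<in> \<int>)}"
proof -
  let ?R = "{(K, K'). properly_isometric K K'}"
  let ?X = "{K. sublattice K (lat a x d) \<and> lat_index (lat a x d) K = m}"
  let ?Y = "{r :: rat. 0 \<le> r \<and> r < 1 \<and> (\<exists>t n. t * n = m \<and> of_nat t * r - of_nat n * (x / a) \<in> \<int>)}"
  define D where "D = of_nat m * a * d"
  have D: "D > 0" using pos m by (simp add: D_def)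
  have cls: "?R `` {K} = ?R `` {K'} \<longleftrightarrow> properly_isometric K K'" for K K'
    using eq_equiv_class_iff[OF equiv_properly_isometric, of K K'] by simp
  have "?X // ?R = (\<lambda>r. ?R `` {lat 1 r D}) ` ?Y"
  proof (intro subset_antisym subsetI)
    fix C assume "C \<in> ?X // ?R"
    then obtain K where K: "K \<in> ?X" "C = ?R `` {K}" by (auto elim: quotientE)
    have K': "sublattice K (lat a x d)" using K by simp
    obtain a' x' d' where lat: "a' > 0" "d' > 0" "K = lat a' x' d'"
      using sublattice_is_lat[OF L K'] by blast
    have "lat a' x' d' \<subseteq> lat a x d" using K' lat by (simp add: sublattice_def)
    then obtain t n l :: int where tn: "t > 0" "n > 0" "a' = of_int t * a" "d' = of_int n * d"
              "x' = of_int n * x + of_int l * a"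
      using lat_subset_iff[OF pos lat(1,2)] by blast
    have idx: "t * n = int m"
      using lat_index_lat(2)[OF pos tn(1,2), of K x l] K lat tn by simp
    \<comment> \<open>replacing the offset by its fractional part changes \<open>t r - n (x / a)\<close> by an integer only\<close>
    define r where "r = frac (x' / a')"
    obtain f :: int where r: "0 \<le> r" "r < 1" "x' / a' = r + of_int f"
      unfolding r_def using frac_ge_0 frac_lt_1 by (metis frac_def diff_add_cancel)
    have eq: "of_nat (nat t) * r - of_nat (nat n) * (x / a) = of_int (l - t * f)"
    proof -
      have "of_int t * (x' / a') - of_int n * (x / a) = of_int l"
        unfolding tn using tn(1,2) pos by (simp add: field_simps)
      hence "of_int t * (r + of_int f) - of_int n * (x / a) = of_int l"
        unfolding r(3) .
      thus ?thesis using tn(1,2) by (simp add: algebra_simps)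
    qed
    have "of_nat (nat t) * r - of_nat (nat n) * (x / a) \<in> \<int>"
      unfolding eq by (rule Ints_of_int)
    moreover have "nat t * nat n = m" using idx tn(1,2) by (simp flip: nat_mult_distrib)
    ultimately have rY: "r \<in> ?Y" using r(1,2) by blast
    have "a' * d' = D"
    proof -
      have "a' * d' = of_int (t * n) * a * d" by (simp add: tn)
      thus ?thesis unfolding idx D_def by simp
    qed
    hence "properly_isometric K (lat 1 r D)"
      unfolding lat(3) using lat(1,2) D r(3) by (subst properly_isometric_lat_iff) auto
    hence "C = ?R `` {lat 1 r D}" using K(2) cls by simp
    thus "C \<in> (\<lambda>r. ?R `` {lat 1 r D}) ` ?Y" using rY by blast
  next
    fix C assume "C \<in> (\<lambda>r. ?R `` {lat 1 r D}) ` ?Y"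
    then obtain r t n where r: "t * n = m" "of_nat t * r - of_nat n * (x / a) \<in> \<int>"
      "C = ?R `` {lat 1 r D}" by blast
    then obtain l where l: "of_nat t * r - of_nat n * (x / a) = of_int l" by (auto elim: Ints_cases)
    have tn: "t > 0" "n > 0" using r(1) m by (auto intro!: Nat.gr0I)
    define K where "K = lat (of_int (int t) * a) (of_int (int n) * x + of_int l * a) (of_int (int n) * d)"
    have idx: "finite (cosets (lat a x d) K)" "int (lat_index (lat a x d) K) = int t * int n"
      using lat_index_lat[OF pos _ _ K_def] tn by auto
    have pos': "of_int (int t) * a > 0" "of_int (int n) * d > 0" using tn pos by simp_all
    have "K \<subseteq> lat a x d"
      unfolding K_def lat_subset_iff[OF pos pos'] using tn
      by (intro exI[of _ "int t"] exI[of _ "int n"] exI[of _ l]) simp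
    hence KX: "K \<in> ?X"
      using idx r(1) add_subgroup_lat unfolding sublattice_def K_def by (auto simp flip: of_nat_mult)
    have "of_int (int n) * x + of_int l * a = of_int (int t) * a * r"
      using l pos by (simp add: field_simps)
    hence "(of_int (int n) * x + of_int l * a) / (of_int (int t) * a) = r"
      using pos tn by simp
    moreover have "of_int (int t) * a * (of_int (int n) * d) = D"
      unfolding D_def r(1)[symmetric] by simp
    ultimately have "properly_isometric K (lat 1 r D)"
      unfolding K_def using pos' D by (subst properly_isometric_lat_iff) auto
    hence "?R `` {K} = ?R `` {lat 1 r D}" by (rule cls[THEN iffD2])
    hence "C = ?R `` {K}" unfolding r(3) by (rule sym)
    show "C \<in> ?X // ?R" unfolding \<open>C = ?R `` {K}\<close> by (rule quotientI[OF KX])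
  qed
  moreover have "inj_on (\<lambda>r. ?R `` {lat 1 r D}) ?Y"
  proof (rule inj_onI)
    fix r r' assume r: "r \<in> ?Y" "r' \<in> ?Y" and eq: "?R `` {lat 1 r D} = ?R `` {lat 1 r' D}"
    have "properly_isometric (lat 1 r D) (lat 1 r' D)" using eq by (simp only: cls)
    hence "r' - r \<in> \<int>" using properly_isometric_lat_iff[of 1 D 1 D r r'] D by simp
    then obtain l where l: "r' - r = of_int l" by (auto elim: Ints_cases)
    have "r' - r < 1" "r' - r > -1" using r by auto
    hence "of_int l < (1 :: rat)" "of_int l > (-1 :: rat)" unfolding l .
    hence "l = 0" by linarith
    thus "r = r'" using l by simp
  qed
  ultimately show ?thesis
    unfolding num_proper_classes_def by (simp add: card_image)
qed

lemma Ints_mult_of_int: "(z :: rat) \<in> \<int> \<Longrightarrow> of_int i * z \<in> \<int>"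
  by (auto elim!: Ints_cases simp flip: of_int_mult)

text \<open>The values of \<open>Q\<close> on the lattice are \<open>i j a d + j\<^sup>2 x d\<close>, which generate the same group as
  \<open>a d\<close> and \<open>x d\<close>.\<close>

lemma ideal_inverse_norm_ideal_lat:
  "y \<in> ideal_inverse (norm_ideal (lat a x d)) \<longleftrightarrow> a * d * y \<in> \<int> \<and> x * d * y \<in> \<int>"
proof -
  have grp: "add_subgroup {z. z * y \<in> \<int>}"
    by (auto simp: add_subgroup_def left_diff_distrib)
  have "y \<in> ideal_inverse (norm_ideal (lat a x d)) \<longleftrightarrow> norm_ideal (lat a x d) \<subseteq> {z. z * y \<in> \<int>}"
    by (auto simp: ideal_inverse_def)
  also have "\<dots> \<longleftrightarrow> Q ` lat a x d \<subseteq> {z. z * y \<in> \<int>}"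
    unfolding norm_ideal_def using grp by (meson dual_order.trans hull_minimal hull_subset)
  also have "\<dots> \<longleftrightarrow> a * d * y \<in> \<int> \<and> x * d * y \<in> \<int>"
  proof
    assume *: "Q ` lat a x d \<subseteq> {z. z * y \<in> \<int>}"
    have "vector [x, d] \<in> lat a x d"
      unfolding vector_in_lat_iff by (intro exI[of _ 0] exI[of _ 1]) simp
    hence "Q (vector [x, d]) \<in> {z. z * y \<in> \<int>}" using * by blast
    hence 1: "x * d * y \<in> \<int>" by (simp add: Q_def)
    have "vector [a + x, d] \<in> lat a x d"
      unfolding vector_in_lat_iff by (intro exI[of _ 1] exI[of _ 1]) simp
    hence "Q (vector [a + x, d]) \<in> {z. z * y \<in> \<int>}" using * by blast
    hence "(a + x) * d * y \<in> \<int>" by (simp add: Q_def)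
    from Ints_diff[OF this 1] 1 show "a * d * y \<in> \<int> \<and> x * d * y \<in> \<int>"
      by (simp add: algebra_simps)
  next
    assume *: "a * d * y \<in> \<int> \<and> x * d * y \<in> \<int>"
    show "Q ` lat a x d \<subseteq> {z. z * y \<in> \<int>}"
    proof clarify
      fix v assume "v \<in> lat a x d"
      then obtain i j :: int where "v $ 1 = of_int i * a + of_int j * x" "v $ 2 = of_int j * d"
        unfolding lat_def by blast
      hence "Q v * y = of_int (i * j) * (a * d * y) + of_int (j * j) * (x * d * y)"
        by (simp add: Q_def algebra_simps)
      also have "\<dots> \<in> \<int>" using * by (intro Ints_add Ints_mult_of_int) auto
      finally show "Q v * y \<in> \<int>" .
    qed
  qed
  finally show ?thesis .
qed

text \<open>The index in the hyperbolic plane is \<open>a d\<close>, so the ideal in the hypothesis consists of the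
  integers \<open>z\<close> for which \<open>(x / a) z\<close> is an integer. That \<open>B\<close> generates it means that \<open>B\<close> is the order of
  \<open>x / a\<close> modulo \<open>1\<close>.\<close>

lemma lat_offset_lowest_terms:
  assumes L: "sublattice (lat a x d) hyp" and pos: "a > 0" "d > 0" and B: "B > 0"
    and eq: "range (\<lambda>n::int. of_nat B * of_int n) =
           of_nat (lat_index hyp (lat a x d)) *o ideal_inverse (norm_ideal (lat a x d))"
  obtains k :: int where "coprime k (int B)" "x / a = of_int k / of_nat B"
proof -
  have "lat a x d \<subseteq> lat 1 0 1" using L by (simp add: sublattice_def hyp_eq_lat)
  then obtain t n l :: int where tn: "t > 0" "n > 0" "a = of_int t * 1" "d = of_int n * 1"
      "x = of_int n * 0 + of_int l * 1"
    using lat_subset_iff[of 1 1 a d x 0] pos by auto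
  have idx: "int (lat_index hyp (lat a x d)) = t * n"
    unfolding hyp_eq_lat by (rule lat_index_lat(2)[of 1 1 t n _ 0 l]) (use tn in auto)
  have "of_nat (lat_index hyp (lat a x d)) = (of_int (int (lat_index hyp (lat a x d))) :: rat)"
    by simp
  also have "\<dots> = a * d" unfolding idx using tn by simp
  finally have idx': "of_nat (lat_index hyp (lat a x d)) = a * d" .
  \<comment> \<open>the substitution \<open>z = a d y\<close> turns the two conditions on \<open>y\<close> into this form\<close>
  have char: "z \<in> range (\<lambda>n::int. of_nat B * of_int n) \<longleftrightarrow> z \<in> \<int> \<and> x / a * z \<in> \<int>" for z :: rat
  proof -
    have "z \<in> range (\<lambda>n::int. of_nat B * of_int n) \<longleftrightarrow>
        (\<exists>y. z = a * d * y \<and> y \<in> ideal_inverse (norm_ideal (lat a x d)))"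
      unfolding eq idx' by (auto simp: elt_set_times_def)
    also have "\<dots> \<longleftrightarrow> (\<exists>y. z = a * d * y \<and> a * d * y \<in> \<int> \<and> x * d * y \<in> \<int>)"
      unfolding ideal_inverse_norm_ideal_lat ..
    also have "\<dots> \<longleftrightarrow> z \<in> \<int> \<and> x / a * z \<in> \<int>"
    proof
      assume "z \<in> \<int> \<and> x / a * z \<in> \<int>"
      moreover have "z = a * d * (z / (a * d))" using pos by simp
      moreover have "x * d * (z / (a * d)) = x / a * z" using pos by (simp add: field_simps)
      ultimately show "\<exists>y. z = a * d * y \<and> a * d * y \<in> \<int> \<and> x * d * y \<in> \<int>" by metis
    qed (use pos in \<open>auto simp: mult.assoc\<close>)
    finally show ?thesis .
  qed
  have "of_nat B \<in> range (\<lambda>n::int. of_nat B * of_int n :: rat)" by (rule range_eqI[of _ _ 1]) simp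
  hence "x / a * of_nat B \<in> \<int>" using char by blast
  then obtain k where k: "x / a * of_nat B = of_int k" by (auto elim: Ints_cases)
  have k': "x / a = of_int k / of_nat B" using k B by (simp add: field_simps)
  have "coprime k (int B)"
  proof (rule coprimeI)
    \<comment> \<open>for a common divisor \<open>g\<close>, the multiple \<open>B / g\<close> of the offset is already integral\<close>
    fix g assume g: "g dvd k" "g dvd int B"
    then obtain k1 B1 where kB: "k = g * k1" "int B = g * B1" by (auto elim!: dvdE)
    have g0: "g \<noteq> 0" "B1 \<noteq> 0" using kB B by auto
    have B': "of_nat B = (of_int g * of_int B1 :: rat)" using arg_cong[OF kB(2), of "of_int :: int \<Rightarrow> rat"] by simp
    have "x / a * of_int B1 = of_int k1" unfolding k' B' kB(1) using g0 by simp
    hence "of_int B1 \<in> range (\<lambda>n::int. of_nat B * of_int n :: rat)" unfolding char by simp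
    then obtain e where e: "of_int B1 = (of_nat B * of_int e :: rat)" by blast
    hence "(of_int B1 :: rat) = of_int (int B * e)" by simp
    hence "B1 = g * B1 * e" unfolding of_int_eq_iff kB(2) .
    hence "g * e = 1" using g0 by simp
    thus "is_unit g" by (metis dvdI)
  qed
  thus ?thesis using that k' by blast
qed

section \<open>Sums of completely multiplicative terms\<close>

text \<open>Summability is always unordered here, as in the sums of the theorem.\<close>

no_notation Infinite_Set_Sum.abs_summable_on (infix \<open>abs'_summable'_on\<close> 50)

text \<open>The term \<open>n\<^sup>-\<^sup>s\<close> of a Dirichlet series, including the value \<open>0\<close> at \<open>n = 0\<close>; it is named so that
  its complete multiplicativity can be used without unfolding complex powers.\<close>

definition dpow :: "complex \<Rightarrow> nat \<Rightarrow> complex" where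
  "dpow s n = of_nat n powr (-s)"

lemma dpow_1 [simp]: "dpow s (Suc 0) = 1" "dpow s 1 = 1"
  by (simp_all add: dpow_def)

lemma dpow_mult: "dpow s (m * n) = dpow s m * dpow s n"
  by (simp add: dpow_def powr_times_real)

lemma dpow_prod: "dpow s (\<Prod>i\<in>I. f i) = (\<Prod>i\<in>I. dpow s (f i))"
  by (induction I rule: infinite_finite_induct) (auto simp: dpow_mult)

lemma dpow_prod_list: "dpow s (prod_list xs) = (\<Prod>i\<leftarrow>xs. dpow s i)"
  by (induction xs) (auto simp: dpow_mult)

lemma dpow_power: "dpow s (n ^ k) = dpow s n ^ k"
  by (induction k) (auto simp: dpow_mult)

lemma norm_dpow: "norm (dpow s n) = real n powr (- Re s)"
  by (cases "n = 0") (auto simp: dpow_def norm_powr_real_powr)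

lemma dpow_abs_summable:
  assumes "Re s > 1"
  shows   "dpow s abs_summable_on A"
proof -
  have "summable (\<lambda>n. norm (dpow s n))"
    unfolding norm_dpow using assms by (subst summable_real_powr_iff) auto
  hence "dpow s abs_summable_on UNIV"
    by (subst summable_on_UNIV_nonneg_real_iff) auto
  thus ?thesis
    by (rule summable_on_subset_banach) auto
qed

lemma dpow_summable: "Re s > 1 \<Longrightarrow> dpow s summable_on A"
  by (rule abs_summable_summable[OF dpow_abs_summable])

lemma infsum_Times_mult:
  fixes f :: "'a \<Rightarrow> complex" and g :: "'b \<Rightarrow> complex"
  assumes "f abs_summable_on A" and "g abs_summable_on B"
  shows   "(\<lambda>(x, y). f x * g y) abs_summable_on A \<times> B"
    and   "infsum (\<lambda>(x, y). f x * g y) (A \<times> B) = infsum f A * infsum g B"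
proof -
  show *: "(\<lambda>(x, y). f x * g y) abs_summable_on A \<times> B"
  proof (rule Infinite_Sum.abs_summable_on_Sigma_iff[THEN iffD2], intro conjI ballI)
    fix x
    show "(\<lambda>y. case (x, y) of (x, y) \<Rightarrow> f x * g y) abs_summable_on B"
      using summable_on_cmult_right[OF assms(2), of "norm (f x)"] by (simp add: norm_mult)
  next
    have "(\<lambda>x. norm (f x) * infsum (\<lambda>y. norm (g y)) B) summable_on A"
      by (rule summable_on_cmult_left[OF assms(1)])
    hence "(\<lambda>x. norm (f x) * infsum (\<lambda>y. norm (g y)) B) abs_summable_on A"
      by (rule summable_on_iff_abs_summable_on_real[THEN iffD1])
    thus "(\<lambda>x. \<Sum>\<^sub>\<infinity>y\<in>B. norm (case (x, y) of (x, y) \<Rightarrow> f x * g y)) abs_summable_on A"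
      by (simp add: norm_mult infsum_cmult_right')
  qed
  show "infsum (\<lambda>(x, y). f x * g y) (A \<times> B) = infsum f A * infsum g B"
  proof -
    have "infsum (\<lambda>(x, y). f x * g y) (A \<times> B) = infsum (\<lambda>x. infsum (\<lambda>y. f x * g y) B) A"
      by (rule infsum_Sigma'_banach[OF abs_summable_summable[OF *], symmetric])
    thus ?thesis by (simp only: infsum_cmult_right' infsum_cmult_left')
  qed
qed

text \<open>Grouping the terms of an unconditionally convergent sum by the value of a map. It is the tool by
  which sums over several variables become Dirichlet series, and series over integers become sums
  over factorization types.\<close>

lemma infsum_fibres:
  fixes F :: "'a \<Rightarrow> complex"
  assumes "F summable_on A" and "\<phi> ` A \<subseteq> I"
  shows   "(\<lambda>i. infsum F {x\<in>A. \<phi> x = i}) summable_on I"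
    and   "infsum (\<lambda>i. infsum F {x\<in>A. \<phi> x = i}) I = infsum F A"
proof -
  let ?S = "Sigma I (\<lambda>i. {x\<in>A. \<phi> x = i})"
  have bij: "bij_betw snd ?S A"
    by (rule bij_betw_byWitness[of _ "\<lambda>x. (\<phi> x, x)"]) (use assms(2) in auto)
  have summ: "(\<lambda>(i, x). F x) summable_on ?S"
    using assms(1) summable_on_reindex_bij_betw[OF bij, of F] by (simp add: case_prod_unfold)
  show "(\<lambda>i. infsum F {x\<in>A. \<phi> x = i}) summable_on I"
    using summable_on_Sigma_banach[OF summ] .
  show "infsum (\<lambda>i. infsum F {x\<in>A. \<phi> x = i}) I = infsum F A"
    using infsum_Sigma'_banach[OF summ] infsum_reindex_bij_betw[OF bij, of F]
    unfolding case_prod_unfold by simp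
qed

section \<open>Integers with prescribed prime factors\<close>

definition naturals_over :: "nat set \<Rightarrow> nat set" where
  "naturals_over P = {n. n > 0 \<and> prime_factors n \<subseteq> P}"

definition part_over :: "nat set \<Rightarrow> nat \<Rightarrow> nat" where
  "part_over P n = prod_mset (filter_mset (\<lambda>p. p \<in> P) (prime_factorization n))"

lemma prime_factorization_part_over:
  "prime_factorization (part_over P n) = filter_mset (\<lambda>p. p \<in> P) (prime_factorization n)"
  unfolding part_over_def by (rule prime_factorization_prod_mset_primes) auto

lemma part_over_pos: "part_over P n > 0"
  unfolding part_over_def using prod_mset_zero_iff by (auto intro!: gr0I)

lemma part_over_in_naturals_over: "part_over P n \<in> naturals_over P"
  using part_over_pos by (auto simp: naturals_over_def prime_factorization_part_over)

lemma part_over_mult: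
  "m > 0 \<Longrightarrow> n > 0 \<Longrightarrow> part_over P (m * n) = part_over P m * part_over P n"
  by (simp add: part_over_def prime_factorization_mult)

lemma part_over_1 [simp]: "part_over P (Suc 0) = Suc 0"
  by (simp add: part_over_def)

lemma part_over_prod:
  assumes "\<And>u. u \<in> U \<Longrightarrow> g u > 0"
  shows   "part_over P (\<Prod>u\<in>U. g u) = (\<Prod>u\<in>U. part_over P (g u))"
  using assms by (induction U rule: infinite_finite_induct) (auto simp: part_over_mult prod_pos)

lemma part_over_self: "n \<in> naturals_over P \<Longrightarrow> part_over P n = n"
proof -
  assume n: "n \<in> naturals_over P"
  hence "filter_mset (\<lambda>p. p \<in> P) (prime_factorization n) = prime_factorization n"
    by (intro filter_mset_eq_conv[THEN iffD2]) (auto simp: naturals_over_def)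
  thus ?thesis using n
    by (simp add: part_over_def naturals_over_def prod_mset_prime_factorization_nat)
qed

lemma part_over_disjoint: "n \<in> naturals_over P \<Longrightarrow> P \<inter> P' = {} \<Longrightarrow> part_over P' n = 1"
proof -
  assume "n \<in> naturals_over P" "P \<inter> P' = {}"
  hence *: "filter_mset (\<lambda>p. p \<in> P') (prime_factorization n) = {#}"
    by (auto simp: naturals_over_def)
  show ?thesis unfolding part_over_def * by simp
qed

lemma part_over_Un:
  assumes "P \<inter> P' = {}"
  shows   "part_over (P \<union> P') n = part_over P n * part_over P' n"
proof -
  have "filter_mset (\<lambda>p. p \<in> P \<union> P') A = filter_mset (\<lambda>p. p \<in> P) A + filter_mset (\<lambda>p. p \<in> P') A"
    for A :: "nat multiset"
    using assms by (induction A) auto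
  thus ?thesis by (simp add: part_over_def)
qed

lemma part_over_UN:
  assumes "finite U" "disjoint_family_on P U"
  shows   "part_over (\<Union>u\<in>U. P u) n = (\<Prod>u\<in>U. part_over (P u) n)"
  using assms
proof (induction U)
  case empty
  thus ?case by (simp add: part_over_def)
next
  case (insert u U)
  have "P u \<inter> (\<Union>u\<in>U. P u) = {}"
    using insert by (auto simp: disjoint_family_on_def)
  moreover have "disjoint_family_on P U"
    using insert.prems by (rule disjoint_family_on_mono[rotated]) auto
  ultimately show ?case
    using insert by (simp add: part_over_Un)
qed

lemma naturals_over_mono: "P \<subseteq> P' \<Longrightarrow> naturals_over P \<subseteq> naturals_over P'"
  by (auto simp: naturals_over_def)

lemma naturals_over_prod:
  assumes "finite U" "\<And>u. u \<in> U \<Longrightarrow> g u \<in> naturals_over P"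
  shows   "(\<Prod>u\<in>U. g u) \<in> naturals_over P"
proof -
  have "g u > 0" if "u \<in> U" for u
    using assms(2)[OF that] by (simp add: naturals_over_def)
  hence "0 \<notin> g ` U" by force
  hence "prime_factors (\<Prod>u\<in>U. g u) = (\<Union>u\<in>U. prime_factors (g u))"
    using assms(1) by (subst prime_factors_prod) auto
  moreover have "(\<Prod>u\<in>U. g u) > 0"
    using assms by (intro prod_pos) (auto simp: naturals_over_def)
  ultimately show ?thesis using assms by (auto simp: naturals_over_def)
qed

lemma part_over_prod_block:
  assumes fin: "finite U" and disj: "disjoint_family_on P U"
    and g: "\<And>v. v \<in> U \<Longrightarrow> g v \<in> naturals_over (P v)" and u: "u \<in> U"
  shows   "part_over (P u) (\<Prod>v\<in>U. g v) = g u"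
proof -
  have "part_over (P u) (\<Prod>v\<in>U. g v) = (\<Prod>v\<in>U. part_over (P u) (g v))"
    by (rule part_over_prod) (use g in \<open>auto simp: naturals_over_def\<close>)
  also have "\<dots> = (\<Prod>v\<in>U. if v = u then g u else 1)"
  proof (intro prod.cong refl)
    fix v assume v: "v \<in> U"
    show "part_over (P u) (g v) = (if v = u then g u else 1)"
    proof (cases "v = u")
      case False
      hence "P v \<inter> P u = {}" using disj u v by (auto simp: disjoint_family_on_def)
      thus ?thesis using False part_over_disjoint[OF g[OF v]] by simp
    qed (use part_over_self[OF g[OF v]] in auto)
  qed
  also have "\<dots> = g u" using fin u by simp
  finally show ?thesis .
qed

text \<open>Unique factorization, for finitely many disjoint blocks of primes. The predicates
  \<open>R\<close> restrict the parts belonging to the single blocks; they will prescribe the number of prime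
  factors in each block.\<close>

lemma bij_betw_prod_naturals_over:
  assumes fin: "finite U" and disj: "disjoint_family_on P U"
  shows "bij_betw (\<lambda>g. \<Prod>u\<in>U. g u) (PiE U (\<lambda>u. {n \<in> naturals_over (P u). R u n}))
           {n \<in> naturals_over (\<Union>u\<in>U. P u). \<forall>u\<in>U. R u (part_over (P u) n)}"
proof (rule bij_betw_byWitness[of _ "\<lambda>n. \<lambda>u\<in>U. part_over (P u) n"])
  have part: "part_over (P u) (\<Prod>v\<in>U. g v) = g u"
    if g: "g \<in> PiE U (\<lambda>u. {n \<in> naturals_over (P u). R u n})" and u: "u \<in> U" for g u
    by (rule part_over_prod_block[OF fin disj _ u]) (use g in auto)
  show "\<forall>g\<in>PiE U (\<lambda>u. {n \<in> naturals_over (P u). R u n}).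
          (\<lambda>u\<in>U. part_over (P u) (\<Prod>v\<in>U. g v)) = g"
  proof
    fix g assume g: "g \<in> PiE U (\<lambda>u. {n \<in> naturals_over (P u). R u n})"
    show "(\<lambda>u\<in>U. part_over (P u) (\<Prod>v\<in>U. g v)) = g"
      by (rule PiE_ext[OF _ g]) (use part[OF g] g in auto)
  qed
  show "(\<lambda>g. \<Prod>u\<in>U. g u) ` PiE U (\<lambda>u. {n \<in> naturals_over (P u). R u n})
          \<subseteq> {n \<in> naturals_over (\<Union>u\<in>U. P u). \<forall>u\<in>U. R u (part_over (P u) n)}"
  proof safe
    fix g assume g: "g \<in> PiE U (\<lambda>u. {n \<in> naturals_over (P u). R u n})"
    show "(\<Prod>u\<in>U. g u) \<in> naturals_over (\<Union>u\<in>U. P u)"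
    proof (rule naturals_over_prod[OF fin])
      fix u assume "u \<in> U"
      moreover from this have "g u \<in> naturals_over (P u)" using g by auto
      ultimately show "g u \<in> naturals_over (\<Union>u\<in>U. P u)"
        using naturals_over_mono[of "P u" "\<Union>u\<in>U. P u"] by blast
    qed
    fix u assume u: "u \<in> U"
    show "R u (part_over (P u) (\<Prod>u\<in>U. g u))"
      using part[OF g u] g u by auto
  qed
  show "\<forall>n\<in>{n \<in> naturals_over (\<Union>u\<in>U. P u). \<forall>u\<in>U. R u (part_over (P u) n)}.
          (\<Prod>u\<in>U. (\<lambda>u\<in>U. part_over (P u) n) u) = n"
    by (simp add: part_over_UN[OF fin disj, symmetric] part_over_self)
  show "(\<lambda>n. \<lambda>u\<in>U. part_over (P u) n) `
          {n \<in> naturals_over (\<Union>u\<in>U. P u). \<forall>u\<in>U. R u (part_over (P u) n)}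
          \<subseteq> PiE U (\<lambda>u. {n \<in> naturals_over (P u). R u n})"
    by (auto simp: part_over_in_naturals_over)
qed

text \<open>This one identity serves three purposes: with singleton blocks it is the finite Euler product,
  with the blocks of primes having a given square it multiplies the Euler products of the blocks, and
  with a prescribed number of prime factors in each block it multiplies symmetric functions.\<close>

lemma prod_infsum_naturals_over:
  assumes "Re s > 1" "finite U" "disjoint_family_on P U"
  shows "(\<Prod>u\<in>U. infsum (dpow s) {n \<in> naturals_over (P u). R u n}) =
           infsum (dpow s) {n \<in> naturals_over (\<Union>u\<in>U. P u). \<forall>u\<in>U. R u (part_over (P u) n)}"
proof -
  have "(\<Prod>u\<in>U. infsum (dpow s) {n \<in> naturals_over (P u). R u n}) =
          infsum (\<lambda>g. \<Prod>u\<in>U. dpow s (g u)) (PiE U (\<lambda>u. {n \<in> naturals_over (P u). R u n}))"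
    using assms by (intro infsum_prod_PiE_abs[symmetric] dpow_abs_summable)
  also have "\<dots> = infsum (\<lambda>g. dpow s (\<Prod>u\<in>U. g u)) (PiE U (\<lambda>u. {n \<in> naturals_over (P u). R u n}))"
    by (simp add: dpow_prod)
  also have "\<dots> = infsum (dpow s) {n \<in> naturals_over (\<Union>u\<in>U. P u). \<forall>u\<in>U. R u (part_over (P u) n)}"
    by (rule infsum_reindex_bij_betw[OF bij_betw_prod_naturals_over[OF assms(2,3)]])
  finally show ?thesis .
qed

text \<open>A weakly increasing list of primes is the same as an integer together with its prime
  factorization, and complete multiplicativity turns the monomial into the term of that integer.\<close>

lemma Sym_dpow:
  assumes P: "\<And>p. p \<in> P \<Longrightarrow> prime p"
  shows "Sym k P (dpow s) = infsum (dpow s) {n \<in> naturals_over P. size (prime_factorization n) = k}"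
proof -
  let ?A = "{xs. length xs = k \<and> sorted xs \<and> set xs \<subseteq> P}"
  have pf: "prime_factorization (prod_list xs) = mset xs" if "set xs \<subseteq> P" for xs
  proof -
    have "prime_factorization (prod_mset (mset xs)) = mset xs"
      by (rule prime_factorization_prod_mset_primes) (use that P in auto)
    thus ?thesis by (simp add: prod_mset_prod_list)
  qed
  have "bij_betw prod_list ?A {n \<in> naturals_over P. size (prime_factorization n) = k}"
  proof (rule bij_betw_byWitness[of _ "\<lambda>n. sorted_list_of_multiset (prime_factorization n)"])
    show "\<forall>xs\<in>?A. sorted_list_of_multiset (prime_factorization (prod_list xs)) = xs"
      by (auto simp: pf sorted_sort_id)
    have "prod_list (sorted_list_of_multiset (prime_factorization n)) = n" if "n > 0" for n :: nat
      using that by (metis mset_sorted_list_of_multiset prod_mset_prod_list prod_mset_prime_factorization_nat)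
    thus "\<forall>n\<in>{n \<in> naturals_over P. size (prime_factorization n) = k}.
            prod_list (sorted_list_of_multiset (prime_factorization n)) = n"
      by (auto simp: naturals_over_def)
    have "prod_list xs > 0" if "set xs \<subseteq> P" for xs
      using that by (induction xs) (auto dest: P intro: prime_gt_0_nat)
    thus "prod_list ` ?A \<subseteq> {n \<in> naturals_over P. size (prime_factorization n) = k}"
      by (auto simp: pf naturals_over_def)
    show "(\<lambda>n. sorted_list_of_multiset (prime_factorization n)) `
            {n \<in> naturals_over P. size (prime_factorization n) = k} \<subseteq> ?A"
      by (auto simp: naturals_over_def simp flip: size_mset)
  qed
  from infsum_reindex_bij_betw[OF this, of "dpow s"] show ?thesis
    by (simp add: Sym_def dpow_prod_list)
qed

lemma infsum_naturals_over_prime: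
  assumes "prime p" "Re s > 1"
  shows   "infsum (dpow s) (naturals_over {p}) = inverse (1 - dpow s p)"
proof -
  have "bij_betw (\<lambda>k. p ^ k) UNIV (naturals_over {p})"
  proof (rule bij_betw_byWitness[of _ "multiplicity p"])
    have "prime_factors (p ^ k) \<subseteq> {p}" for k
      
    proof
      fix q assume "q \<in> prime_factors (p ^ k)"
      hence "prime q" "q dvd p" by (auto intro: prime_dvd_power)
      thus "q \<in> {p}" using assms(1) primes_dvd_imp_eq by blast
    qed
    thus "range (\<lambda>k. p ^ k) \<subseteq> naturals_over {p}"
      using assms(1) by (auto simp: naturals_over_def prime_gt_0_nat)
    show "\<forall>n\<in>naturals_over {p}. p ^ multiplicity p n = n"
    proof
      fix n assume n: "n \<in> naturals_over {p}"
      hence "n = (\<Prod>q\<in>prime_factors n. q ^ multiplicity q n)"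
        by (intro prime_factorization_nat) (auto simp: naturals_over_def)
      also have "\<dots> = (\<Prod>q\<in>{p}. q ^ multiplicity q n)"
        using n assms(1) by (intro prod.mono_neutral_left)
           (auto simp: naturals_over_def prime_factors_multiplicity)
      finally show "p ^ multiplicity p n = n" by simp
    qed
  qed (use assms(1) in \<open>auto simp: multiplicity_same_power\<close>)
  hence "infsum (dpow s) (naturals_over {p}) = infsum (\<lambda>k. dpow s p ^ k) UNIV"
    using infsum_reindex_bij_betw[of "\<lambda>k. p ^ k" UNIV _ "dpow s"] by (simp add: dpow_power)
  also have "norm (dpow s p) < 1"
    using assms prime_gt_1_nat[of p] by (simp add: norm_dpow powr_less_one)
  hence "((\<lambda>k. dpow s p ^ k) has_sum (1 / (1 - dpow s p))) UNIV"
    by (intro norm_summable_imp_has_sum geometric_sums)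
       (simp_all add: norm_power summable_geometric)
  hence "infsum (\<lambda>k. dpow s p ^ k) UNIV = inverse (1 - dpow s p)"
    by (simp add: infsumI inverse_eq_divide)
  finally show ?thesis .
qed

text \<open>The partial products are the sums over the integers with prime factors in \<open>P \<inter> {..n}\<close>, and
  these exhaust the integers with prime factors in \<open>P\<close>. The product does not vanish because it
  converges absolutely and has nonzero factors.\<close>

lemma euler_prod_dpow:
  assumes P: "\<And>p. p \<in> P \<Longrightarrow> prime p" and s: "Re s > 1"
  shows   "euler_prod P s = infsum (dpow s) (naturals_over P)"
    and   "euler_prod P s \<noteq> 0"
proof -
  define f where "f n = (if n \<in> P then inverse (1 - dpow s n) else 1)" for n
  have less: "norm (dpow s n) \<le> 1 / 2" if "n \<in> P" for n
  proof -
    have n: "n \<ge> 2" using P[OF that] by (rule prime_ge_2_nat)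
    have "real n powr (- Re s) \<le> real n powr (-1)"
      using n s by (intro powr_mono) auto
    also have "\<dots> \<le> 1 / 2" using n by (simp add: powr_minus field_simps)
    finally show ?thesis by (simp add: norm_dpow)
  qed
  have nz: "f n \<noteq> 0" for n
    using less[of n] by (auto simp: f_def)
  \<comment> \<open>as \<open>f n - 1 = z / (1 - z)\<close> for \<open>z = n\<^sup>-\<^sup>s\<close> of norm at most \<open>1/2\<close>\<close>
  have bound: "norm (f n - 1) \<le> 2 * norm (dpow s n)" for n
  proof (cases "n \<in> P")
    case True
    have ne: "1 - dpow s n \<noteq> 0" using less[OF True] by auto
    have "f n - 1 = dpow s n / (1 - dpow s n)"
      using True ne by (simp add: f_def field_simps)
    moreover have "norm (1 - dpow s n) \<ge> 1 / 2"
      using norm_triangle_ineq2[of 1 "dpow s n"] less[OF True] by simp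
    ultimately show ?thesis using ne
      using mult_left_mono[of 1 "2 * norm (1 - dpow s n)" "norm (dpow s n)"]
      by (simp add: norm_divide divide_le_eq mult_ac)
  qed (auto simp: f_def)
  have "summable (\<lambda>n. norm (dpow s n))"
    using s unfolding norm_dpow by (subst summable_real_powr_iff) auto
  hence "summable (\<lambda>n. norm (f n - 1))"
    by (rule summable_comparison_test'[OF summable_mult[of _ 2], where N = 0])
       (simp add: bound)
  hence "convergent_prod f"
    by (intro abs_convergent_prod_imp_convergent_prod) (simp add: abs_convergent_prod_conv_summable)
  note lim = convergent_prod_LIMSEQ[OF this] and nz' = prodinf_nonzero[OF this nz]
  have partial: "(\<Prod>i\<le>n. f i) = infsum (dpow s) (naturals_over (P \<inter> {..n}))" for n
  proof -
    have "(\<Prod>i\<le>n. f i) = (\<Prod>p\<in>P \<inter> {..n}. f p)"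
      by (rule prod.mono_neutral_right) (auto simp: f_def)
    also have "\<dots> = (\<Prod>p\<in>P \<inter> {..n}. infsum (dpow s) {n \<in> naturals_over {p}. True})"
      by (rule prod.cong) (use P s in \<open>auto simp: f_def infsum_naturals_over_prime\<close>)
    also have "\<dots> = infsum (dpow s) {n' \<in> naturals_over (\<Union>p\<in>P \<inter> {..n}. {p}).
                     \<forall>p\<in>P \<inter> {..n}. True}"
      using s by (intro prod_infsum_naturals_over) (auto simp: disjoint_family_on_def)
    finally show ?thesis by simp
  qed
  have "(\<lambda>n. infsum (dpow s) (naturals_over (P \<inter> {..n}))) \<longlonglongrightarrow> infsum (dpow s) (naturals_over P)"
  proof (rule LIMSEQ_I)
    fix e :: real assume e: "e > 0"
    have "(dpow s has_sum infsum (dpow s) (naturals_over P)) (naturals_over P)"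
      using dpow_summable[OF s] by (rule has_sum_infsum)
    show "\<exists>N. \<forall>n\<ge>N. norm (infsum (dpow s) (naturals_over (P \<inter> {..n})) - infsum (dpow s) (naturals_over P)) < e"
    proof -
      let ?g = "\<lambda>n. norm (dpow s n)"
      have g: "?g summable_on A" for A using dpow_abs_summable[OF s] .
      obtain F where F: "finite F" "F \<subseteq> naturals_over P"
        "dist (sum ?g F) (infsum ?g (naturals_over P)) \<le> e / 2"
        using infsum_finite_approximation[OF g, of "e / 2" "naturals_over P"] e by auto
      have "norm (infsum (dpow s) (naturals_over (P \<inter> {..n})) - infsum (dpow s) (naturals_over P)) < e"
        if n: "n \<ge> Max F" for n
      proof -
        let ?A = "naturals_over P" and ?B = "naturals_over (P \<inter> {..n})"
        have BA: "?B \<subseteq> ?A" by (rule naturals_over_mono) auto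
        have FB: "F \<subseteq> ?B"
        proof
          fix x assume x: "x \<in> F"
          hence "x \<le> n" using n Max_ge[OF F(1) x] by linarith
          moreover have "x > 0" using x F(2) by (auto simp: naturals_over_def)
          ultimately have "p \<le> n" if "p \<in> prime_factors x" for p
            using dvd_imp_le[of p x] that by auto
          thus "x \<in> ?B" using x F(2) by (auto simp: naturals_over_def)
        qed
        have "norm (infsum (dpow s) ?B - infsum (dpow s) ?A) = norm (infsum (dpow s) (?A - ?B))"
          using infsum_Diff[OF dpow_summable[OF s] dpow_summable[OF s] BA]
          by (simp add: norm_minus_commute)
        also have "\<dots> \<le> infsum ?g (?A - ?B)"
          by (rule norm_infsum_bound[OF g])
        also have "\<dots> \<le> infsum ?g (?A - F)"
          by (rule infsum_mono2[OF g g]) (use FB in auto)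
        also have "\<dots> = infsum ?g ?A - sum ?g F"
          using infsum_Diff[OF g g F(2)] F(1) by simp
        also have "\<dots> \<le> e / 2" using F(3) unfolding dist_real_def by linarith
        also have "\<dots> < e" using e by simp
        finally show ?thesis .
      qed
      thus ?thesis by blast
    qed
  qed
  hence "prodinf f = infsum (dpow s) (naturals_over P)"
    using lim unfolding partial by (rule LIMSEQ_unique[rotated])
  moreover have "euler_prod P s = prodinf f"
    unfolding euler_prod_def f_def [abs_def] dpow_def ..
  ultimately show "euler_prod P s = infsum (dpow s) (naturals_over P)" "euler_prod P s \<noteq> 0"
    using nz' by simp_all
qed

section \<open>Lifting units from modulus b to modulus bh\<close>

definition unit_lifts :: "nat \<Rightarrow> nat \<Rightarrow> nat \<Rightarrow> nat set" where
  "unit_lifts b h c = {x\<in>{0..<b*h}. coprime x (b * h) \<and> [x = c] (mod b)}"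

definition lift_count :: "nat \<Rightarrow> nat \<Rightarrow> nat" where
  "lift_count b h = card (unit_lifts b h 1)"

definition divisors_coprime_to :: "nat \<Rightarrow> nat \<Rightarrow> nat set" where
  "divisors_coprime_to b h = {g. g dvd h \<and> coprime g b}"

lemma finite_divisors_coprime_to: "h > 0 \<Longrightarrow> finite (divisors_coprime_to b h)"
  by (simp add: divisors_coprime_to_def)

lemma card_residue_class:
  fixes b h c :: nat
  assumes "b > 0"
  shows   "card {x\<in>{0..<b*h}. [x = c] (mod b)} = h"
proof -
  have "bij_betw (\<lambda>i. c mod b + b * i) {0..<h} {x\<in>{0..<b*h}. [x = c] (mod b)}"
  proof (rule bij_betw_byWitness[of _ "\<lambda>x. x div b"])
    have "c mod b + b * i < b * h" if "i < h" for i
    proof -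
      have "c mod b + b * i < b + b * i" using assms by simp
      also have "\<dots> = b * Suc i" by simp
      also have "\<dots> \<le> b * h" using that by (intro mult_left_mono) auto
      finally show ?thesis .
    qed
    thus "(\<lambda>i. c mod b + b * i) ` {0..<h} \<subseteq> {x\<in>{0..<b*h}. [x = c] (mod b)}"
      by (auto simp: cong_def)
    show "\<forall>x\<in>{x\<in>{0..<b*h}. [x = c] (mod b)}. c mod b + b * (x div b) = x"
    proof
      fix x assume "x \<in> {x\<in>{0..<b*h}. [x = c] (mod b)}"
      hence "c mod b = x mod b" by (simp add: cong_def)
      thus "c mod b + b * (x div b) = x" by (simp only: mod_mult_div_eq)
    qed
  qed (use assms in \<open>auto simp: cong_def less_mult_imp_div_less mult.commute\<close>)
  from bij_betw_same_card[OF this] show ?thesis by simp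
qed

text \<open>The class of \<open>c\<close> has \<open>h\<close> elements modulo \<open>b h\<close>. They are sorted by their greatest common divisor
  \<open>g\<close> with \<open>b h\<close>; since \<open>c\<close> is a unit modulo \<open>b\<close>, this divisor is coprime to \<open>b\<close> and divides \<open>h\<close>, and
  division by \<open>g\<close> leaves a unit modulo \<open>b (h / g)\<close>. For \<open>b = 1\<close> this is the identity of Gauss for the
  totient function.\<close>

lemma sum_card_scaled_lifts:
  assumes "b > 0" "h > 0" "coprime c b"
  shows "(\<Sum>g\<in>divisors_coprime_to b h.
            card {x\<in>{0..<b*(h div g)}. coprime x (b*(h div g)) \<and> [x * g = c] (mod b)}) = h"
proof -
  let ?A = "{x\<in>{0..<b*h}. [x = c] (mod b)}"
  let ?G = "divisors_coprime_to b h"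
  let ?F = "\<lambda>g. {x\<in>{0..<b*(h div g)}. coprime x (b*(h div g)) \<and> [x * g = c] (mod b)}"
  have gcd_in: "gcd x (b * h) \<in> ?G" if "x \<in> ?A" for x
  proof -
    have "coprime x b" using that cong_imp_coprime[OF _ assms(3), of x] by (simp add: cong_sym)
    hence cop: "coprime (gcd x (b * h)) b"
      by (rule coprime_divisors[OF gcd_dvd1 dvd_refl])
    moreover have "gcd x (b * h) dvd h"
      using coprime_dvd_mult_right_iff[OF cop, of h] gcd_dvd2[of x "b * h"] by blast
    ultimately show ?thesis by (simp add: divisors_coprime_to_def)
  qed
  have fibre: "card (?F g) = card {x\<in>?A. gcd x (b * h) = g}" if g: "g \<in> ?G" for g
  proof -
    obtain k where k: "h = g * k" using g by (auto simp: divisors_coprime_to_def)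
    have gpos: "g > 0" using k assms(2) by auto
    have div: "h div g = k" using k gpos by simp
    have "bij_betw (\<lambda>x. x * g) (?F g) {x\<in>?A. gcd x (b * h) = g}"
    proof (rule bij_betw_byWitness[of _ "\<lambda>x. x div g"])
      have gcd: "gcd (x * g) (b * h) = g * gcd x (b * k)" for x
        by (simp add: k gcd_mult_distrib_nat mult_ac)
      show "(\<lambda>x. x * g) ` ?F g \<subseteq> {x\<in>?A. gcd x (b * h) = g}"
      proof safe
        fix x assume x: "x \<in> {0..<b*(h div g)}" "coprime x (b*(h div g))" "[x * g = c] (mod b)"
        have "x * g < b * k * g" using x(1) gpos unfolding div by simp
        thus "x * g \<in> {0..<b*h}" by (simp add: k mult_ac)
        show "gcd (x * g) (b * h) = g" using x(2) unfolding gcd div by simp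
      qed
      show "(\<lambda>x. x div g) ` {x\<in>?A. gcd x (b * h) = g} \<subseteq> ?F g"
      proof safe
        fix x assume x: "x \<in> {0..<b*h}" "[x = c] (mod b)" and g': "g = gcd x (b * h)"
        have "g dvd x" unfolding g' by (rule gcd_dvd1)
        then obtain y where y: "x = y * g" by (metis dvd_div_mult_self)
        have xdiv: "x div gcd x (b * h) = y" using y gpos g'[symmetric] by simp
        have div': "h div gcd x (b * h) = k" using div g' by simp
        have "gcd (y * g) (b * h) = g" using g' unfolding y by (rule sym)
        hence "g * gcd y (b * k) = g * 1" unfolding gcd by simp
        hence "gcd y (b * k) = 1" using gpos by (subst (asm) mult_cancel1) simp
        thus "coprime (x div gcd x (b * h)) (b * (h div gcd x (b * h)))"
          unfolding xdiv div' by (simp add: coprime_iff_gcd_eq_1)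
        show "[x div gcd x (b * h) * gcd x (b * h) = c] (mod b)"
          using x(2) by simp
        have "y * g < b * k * g" using x(1) y k by (simp add: mult_ac)
        thus "x div gcd x (b * h) \<in> {0..<b * (h div gcd x (b * h))}"
          unfolding xdiv div' by simp
      qed
      show "\<forall>x\<in>?F g. x * g div g = x" using gpos by simp
      show "\<forall>x\<in>{x\<in>?A. gcd x (b * h) = g}. x div g * g = x" by auto
    qed
    from bij_betw_same_card[OF this] show ?thesis .
  qed
  have "h = card ?A" using card_residue_class[OF assms(1)] by simp
  also have "\<dots> = card (\<Union>g\<in>?G. {x\<in>?A. gcd x (b * h) = g})"
    by (rule arg_cong[where f = card]) (use gcd_in in blast)
  also have "\<dots> = (\<Sum>g\<in>?G. card {x\<in>?A. gcd x (b * h) = g})"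
    by (rule card_UN_disjoint) (use assms(2) in \<open>auto simp: finite_divisors_coprime_to\<close>)
  also have "\<dots> = (\<Sum>g\<in>?G. card (?F g))"
    by (rule sum.cong[OF refl], rule fibre[symmetric])
  finally show ?thesis ..
qed

text \<open>Multiplication by the inverse \<open>c'\<close> of \<open>g\<close> modulo \<open>b\<close>.\<close>

lemma card_scaled_lifts:
  assumes "b > 0" "coprime g b"
  obtains c' where "coprime c' b"
    "{x\<in>{0..<b*h}. coprime x (b*h) \<and> [x * g = c] (mod b)} = unit_lifts b h (c * c')"
proof -
  obtain c' where c': "[g * c' = 1] (mod b)"
    using cong_solve_coprime_nat[OF assms(2)] by auto
  have "coprime (g * c') b"
    using cong_imp_coprime[OF cong_sym[OF c']] by simp
  hence cop: "coprime c' b" by simp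
  have "[x * g = c] (mod b) \<longleftrightarrow> [x = c * c'] (mod b)" for x
  proof -
    have "[x * g = c] (mod b) \<longleftrightarrow> [c' * (x * g) = c' * c] (mod b)"
      using cop by (simp add: cong_mult_lcancel_nat)
    also have "c' * (x * g) = x * (g * c')" by (simp add: mult_ac)
    also have "[x * (g * c') = c' * c] (mod b) \<longleftrightarrow> [x = c' * c] (mod b)"
      using cong_scalar_left[OF c', of x] by (simp add: cong_def)
    finally show ?thesis by (simp add: mult.commute)
  qed
  thus ?thesis using that[OF cop] by (simp add: unit_lifts_def)
qed

text \<open>In \<open>sum_card_scaled_lifts\<close> the term for \<open>g = 1\<close> is the number in question, and by induction the
  other terms do not depend on \<open>c\<close>. Hence neither does this one.\<close>

lemma card_unit_lifts:
  assumes b: "b > 0"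
  shows "h > 0 \<Longrightarrow> coprime c b \<Longrightarrow> card (unit_lifts b h c) = lift_count b h"
proof (induction h arbitrary: c rule: less_induct)
  case (less h)
  let ?G = "divisors_coprime_to b h"
  have one: "1 \<in> ?G" by (simp add: divisors_coprime_to_def)
  have *: "card (unit_lifts b h c) + (\<Sum>g\<in>?G - {1}. lift_count b (h div g)) = h"
    if c: "coprime c b" for c
  proof -
    let ?F = "\<lambda>g. {x\<in>{0..<b*(h div g)}. coprime x (b*(h div g)) \<and> [x * g = c] (mod b)}"
    have "card (?F g) = lift_count b (h div g)" if g: "g \<in> ?G - {1}" for g
    proof -
      have gh: "g dvd h" "coprime g b" "g \<noteq> 1" using g by (auto simp: divisors_coprime_to_def)
      have "g > 0" using dvd_pos_nat[OF less.prems(1) gh(1)] .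
      hence g1: "g > 1" using gh by linarith
      obtain c' where c': "coprime c' b" "?F g = unit_lifts b (h div g) (c * c')"
        using card_scaled_lifts[OF b gh(2)] by blast
      have "h div g < h" using g1 less.prems(1) by simp
      moreover have "h div g > 0"
        using dvd_imp_le[OF gh(1)] less.prems(1) \<open>g > 0\<close> by (simp add: div_greater_zero_iff)
      ultimately show ?thesis using less.IH[of "h div g" "c * c'"] c' c by simp
    qed
    hence "(\<Sum>g\<in>?G - {1}. lift_count b (h div g)) = (\<Sum>g\<in>?G - {1}. card (?F g))" by simp
    moreover have "?F 1 = unit_lifts b h c" by (simp add: unit_lifts_def)
    moreover have "(\<Sum>g\<in>?G. card (?F g)) = card (?F 1) + (\<Sum>g\<in>?G - {1}. card (?F g))"
      by (rule sum.remove[OF finite_divisors_coprime_to[OF less.prems(1)] one])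
    ultimately show ?thesis
      using sum_card_scaled_lifts[OF b less.prems(1) c] by argo
  qed
  have "coprime 1 b" by simp
  from *[OF this] *[OF less.prems(2)] show ?case unfolding lift_count_def by linarith
qed

lemma sum_lift_count:
  assumes "b > 0" "h > 0"
  shows   "(\<Sum>g\<in>divisors_coprime_to b h. lift_count b (h div g)) = h"
proof -
  have "coprime 1 b" by simp
  have "(\<Sum>g\<in>divisors_coprime_to b h. lift_count b (h div g)) = (\<Sum>g\<in>divisors_coprime_to b h.
            card {x\<in>{0..<b*(h div g)}. coprime x (b*(h div g)) \<and> [x * g = 1] (mod b)})"
  proof (rule sum.cong[OF refl])
    fix g assume g: "g \<in> divisors_coprime_to b h"
    hence gh: "g dvd h" "coprime g b" by (auto simp: divisors_coprime_to_def)
    have "h div g > 0"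
      using dvd_imp_le[OF gh(1)] dvd_pos_nat[OF assms(2) gh(1)] assms(2)
      by (simp add: div_greater_zero_iff)
    moreover obtain c' where c': "coprime c' b"
      "{x\<in>{0..<b*(h div g)}. coprime x (b*(h div g)) \<and> [x * g = 1] (mod b)} = unit_lifts b (h div g) (1 * c')"
      using card_scaled_lifts[OF assms(1) gh(2)] by blast
    ultimately show "lift_count b (h div g) = card {x\<in>{0..<b*(h div g)}. coprime x (b*(h div g)) \<and> [x * g = 1] (mod b)}"
      using card_unit_lifts[OF assms(1), of "h div g" "1 * c'"] by simp
  qed
  also have "\<dots> = h" by (rule sum_card_scaled_lifts[OF assms]) simp
  finally show ?thesis .
qed

lemma lift_count_le:
  assumes "b > 0" "h > 0"
  shows   "lift_count b h \<le> h"
proof -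
  have "lift_count b (h div 1) \<le> (\<Sum>g\<in>divisors_coprime_to b h. lift_count b (h div g))"
    by (rule member_le_sum) (use assms in \<open>auto simp: finite_divisors_coprime_to divisors_coprime_to_def\<close>)
  thus ?thesis using sum_lift_count[OF assms] by simp
qed

definition coprime_nats :: "nat \<Rightarrow> nat set" where
  "coprime_nats b = {n. n > 0 \<and> coprime n b}"

lemma coprime_nats_dvd: "M \<in> coprime_nats b \<Longrightarrow> t dvd M \<Longrightarrow> t \<in> coprime_nats b"
  unfolding coprime_nats_def
  using coprime_divisors[of t M b b] dvd_pos_nat[of M t] by simp

section \<open>The Dirichlet series of the lift counts\<close>

lemma dpow_shift: "n > 0 \<Longrightarrow> of_nat n * dpow s n = dpow (s - 1) n"
  by (simp add: dpow_def powr_diff powr_minus field_simps)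

lemma lift_count_abs_summable:
  assumes "b > 0" "Re s > 2"
  shows   "(\<lambda>h. of_nat (lift_count b h) * dpow s h) abs_summable_on {1..}"
proof (rule Infinite_Sum.abs_summable_on_comparison_test)
  show "dpow (s - 1) abs_summable_on {1..}"
    using assms by (intro dpow_abs_summable) auto
  fix h :: nat assume h: "h \<in> {1..}"
  have "norm (of_nat (lift_count b h) * dpow s h) \<le> norm (of_nat h * dpow s h)"
    unfolding norm_mult using lift_count_le[of b h] h assms by (intro mult_right_mono) auto
  also have "\<dots> = norm (dpow (s - 1) h)" using dpow_shift[of h s] h by simp
  finally show "norm (of_nat (lift_count b h) * dpow s h) \<le> norm (dpow (s - 1) h)" .
qed

text \<open>The Dirichlet convolution of \<open>lift_count b\<close> with the indicator function of the integers coprime to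
  \<open>b\<close> is the identity function, by \<open>sum_lift_count\<close>.\<close>

lemma zeta_shift_conv_lift_count:
  assumes b: "b > 0" and s: "Re s > 2"
  shows "infsum (\<lambda>h. of_nat (lift_count b h) * dpow s h) {1..} * infsum (dpow s) (coprime_nats b) =
           zeta (s - 1)"
proof -
  let ?f = "\<lambda>h. of_nat (lift_count b h) * dpow s h"
  let ?F = "\<lambda>(h, g). ?f h * dpow s g"
  let ?A = "{1..} \<times> coprime_nats b"
  have summ: "?f abs_summable_on {1..}" "dpow s abs_summable_on coprime_nats b"
    using lift_count_abs_summable[OF assms] dpow_abs_summable[of s] s by auto
  have "infsum ?f {1..} * infsum (dpow s) (coprime_nats b) = infsum ?F ?A"
    by (rule infsum_Times_mult(2)[OF summ, symmetric])
  also have "\<dots> = infsum (\<lambda>n. infsum ?F {x\<in>?A. (\<lambda>(h, g). h * g) x = n}) {1..}"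
    by (rule infsum_fibres(2)[OF abs_summable_summable[OF infsum_Times_mult(1)[OF summ]], symmetric])
       (auto simp: coprime_nats_def)
  also have "\<dots> = infsum (dpow (s - 1)) {1..}"
  proof (rule infsum_cong)
    fix n :: nat assume "n \<in> {1..}"
    hence n: "n > 0" by simp
    have "bij_betw (\<lambda>g. (n div g, g)) (divisors_coprime_to b n) {x\<in>?A. (\<lambda>(h, g). h * g) x = n}"
    proof (rule bij_betw_byWitness[of _ snd])
      show "(\<lambda>g. (n div g, g)) ` divisors_coprime_to b n \<subseteq> {x\<in>?A. (\<lambda>(h, g). h * g) x = n}"
      proof (rule image_subsetI)
        fix g assume g: "g \<in> divisors_coprime_to b n"
        hence "g dvd n" by (simp add: divisors_coprime_to_def)
        moreover from this have "g > 0" using n by (rule dvd_pos_nat[rotated])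
        moreover have "n div g > 0"
          using dvd_imp_le[OF \<open>g dvd n\<close> n] \<open>g > 0\<close> by (simp add: div_greater_zero_iff)
        ultimately show "(n div g, g) \<in> {x\<in>?A. (\<lambda>(h, g). h * g) x = n}"
          using g by (simp_all add: divisors_coprime_to_def coprime_nats_def)
      qed
    qed (auto simp: divisors_coprime_to_def coprime_nats_def)
    from infsum_reindex_bij_betw[OF this, of ?F]
    have "infsum ?F {x\<in>?A. (\<lambda>(h, g). h * g) x = n} =
            (\<Sum>g\<in>divisors_coprime_to b n. ?f (n div g) * dpow s g)"
      using finite_divisors_coprime_to[OF n, of b] by simp
    also have "\<dots> = (\<Sum>g\<in>divisors_coprime_to b n. of_nat (lift_count b (n div g)) * dpow s n)"
    proof (rule sum.cong[OF refl])
      fix g assume "g \<in> divisors_coprime_to b n"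
      hence "n div g * g = n" by (simp add: divisors_coprime_to_def)
      hence "dpow s n = dpow s (n div g) * dpow s g" by (metis dpow_mult)
      thus "?f (n div g) * dpow s g = of_nat (lift_count b (n div g)) * dpow s n" by simp
    qed
    also have "\<dots> = of_nat (\<Sum>g\<in>divisors_coprime_to b n. lift_count b (n div g)) * dpow s n"
      by (simp add: sum_distrib_right)
    also have "\<dots> = dpow (s - 1) n"
      using sum_lift_count[OF b n] dpow_shift[OF n] by simp
    finally show "infsum ?F {x\<in>?A. (\<lambda>(h, g). h * g) x = n} = dpow (s - 1) n" .
  qed
  also have "\<dots> = zeta (s - 1)" unfolding zeta_def dpow_def ..
  finally show ?thesis .
qed

section \<open>Squares of divisors and the symmetric function sum\<close>

definition divisor_squares :: "nat \<Rightarrow> nat \<Rightarrow> nat set" where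
  "divisor_squares b M = (\<lambda>t. t\<^sup>2 mod b) ` {t. t dvd M}"

text \<open>The tuple \<open>w\<close> whose entry \<open>w\<^sub>u\<close> is the number of prime factors of \<open>M\<close>, with multiplicity, whose
  square is \<open>u\<close> modulo \<open>b\<close>.\<close>

definition factor_type :: "nat \<Rightarrow> nat \<Rightarrow> nat \<Rightarrow> nat" where
  "factor_type b M = (\<lambda>u\<in>square_residues b. size (prime_factorization (part_over (primes_sq b u) M)))"

lemma finite_square_residues [simp]: "finite (square_residues b)"
  by (simp add: square_residues_def unit_residues_def)

lemma square_mod_in_square_residues:
  assumes "b > 0" "coprime a b"
  shows   "a\<^sup>2 mod b \<in> square_residues b"
proof -
  have "a mod b \<in> unit_residues b" using assms by (simp add: unit_residues_def)
  moreover have "a\<^sup>2 mod b = (a mod b)\<^sup>2 mod b" by (simp add: power_mod)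
  ultimately show ?thesis unfolding square_residues_def by blast
qed

lemma square_residues_props:
  assumes "u \<in> square_residues b" "b > 0"
  shows   "u < b" "coprime u b"
  using assms by (auto simp: square_residues_def unit_residues_def)

lemma disjoint_primes_sq: "disjoint_family_on (primes_sq b) (square_residues b)"
proof (cases "b = 0")
  case False
  show ?thesis
    unfolding disjoint_family_on_def
  proof safe
    fix u v p assume uv: "u \<in> square_residues b" "v \<in> square_residues b" "u \<noteq> v"
      and p: "p \<in> primes_sq b u" "p \<in> primes_sq b v"
    have "[u = v] (mod b)" using p by (auto simp: primes_sq_def cong_def)
    hence "u = v" using square_residues_props(1)[OF uv(1)] square_residues_props(1)[OF uv(2)] False
      by (simp add: cong_def)
    thus "p \<in> {}" using uv by simp
  qed
qed (auto simp: square_residues_def unit_residues_def disjoint_family_on_def)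

lemma primes_sq_coprime:
  assumes "b > 0" "u \<in> square_residues b" "p \<in> primes_sq b u"
  shows   "coprime p b"
proof -
  have "coprime (p\<^sup>2) b"
    using assms square_residues_props(2)[OF assms(2,1)] cong_imp_coprime cong_sym
    by (auto simp: primes_sq_def simp del: coprime_power_left_iff) blast
  thus ?thesis by simp
qed

lemma UN_primes_sq:
  assumes "b > 0"
  shows   "(\<Union>u\<in>square_residues b. primes_sq b u) = {p. prime p \<and> coprime p b}"
proof (intro subset_antisym subsetI)
  fix p assume "p \<in> {p. prime p \<and> coprime p b}"
  thus "p \<in> (\<Union>u\<in>square_residues b. primes_sq b u)"
    using square_mod_in_square_residues[OF assms, of p]
    by (auto simp: primes_sq_def cong_def intro!: bexI[of _ "p\<^sup>2 mod b"])
qed (use assms primes_sq_coprime in \<open>auto simp: primes_sq_def\<close>)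

lemma coprime_nats_eq_naturals_over:
  assumes "b > 0"
  shows   "coprime_nats b = naturals_over (\<Union>u\<in>square_residues b. primes_sq b u)"
proof -
  have "coprime n b \<longleftrightarrow> (\<forall>p\<in>prime_factors n. coprime p b)" if "n > 0" for n
  proof
    assume "coprime n b"
    thus "\<forall>p\<in>prime_factors n. coprime p b"
      using coprime_divisors[OF in_prime_factors_imp_dvd dvd_refl] by blast
  next
    assume *: "\<forall>p\<in>prime_factors n. coprime p b"
    show "coprime n b"
    proof (rule ccontr)
      assume "\<not> coprime n b"
      then obtain p where p: "prime p" "p dvd n" "p dvd b"
        using prime_factor_nat by (metis dvd_trans is_unit_gcd gcd_dvd1 gcd_dvd2 One_nat_def nat_dvd_1_iff_1)
      hence "coprime p b" using * that by (auto simp: in_prime_factors_iff)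
      thus False using p by (metis coprime_absorb_left not_prime_unit)
    qed
  qed
  thus ?thesis
    unfolding coprime_nats_def naturals_over_def UN_primes_sq[OF assms]
    by (auto simp: in_prime_factors_iff)
qed

lemma factor_type_in_tuples: "factor_type b M \<in> tuples b"
  by (auto simp: factor_type_def tuples_def)

lemma size_part_over:
  "size (prime_factorization (part_over P n)) = size (filter_mset (\<lambda>p. p \<in> P) (prime_factorization n))"
  by (simp add: prime_factorization_part_over)

text \<open>Each prime factor \<open>p\<close> of \<open>g\<close> contributes one factor \<open>u \<equiv> p\<^sup>2\<close> on the left.\<close>

lemma prod_square_residues_factor_type:
  assumes b: "b > 0" and g: "g \<in> coprime_nats b"
  shows   "[(\<Prod>u\<in>square_residues b. u ^ factor_type b g u) = g\<^sup>2] (mod b)"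
proof -
  have "[(\<Prod>u\<in>square_residues b. u ^ size (filter_mset (\<lambda>p. p \<in> primes_sq b u) A)) = (prod_mset A)\<^sup>2] (mod b)"
    if "\<And>p. p \<in># A \<Longrightarrow> prime p \<and> coprime p b" for A
    using that
  proof (induction A)
    case (add p A)
    have "prime p" "coprime p b" using add.prems by auto
    then obtain v where v: "v \<in> square_residues b" "p \<in> primes_sq b v"
      using UN_primes_sq[OF b] by blast
    have v': "p \<in> primes_sq b u \<longleftrightarrow> u = v" if "u \<in> square_residues b" for u
      using that v disjoint_primes_sq[of b] by (auto simp: disjoint_family_on_def)
    have "(\<Prod>u\<in>square_residues b. u ^ size (filter_mset (\<lambda>p. p \<in> primes_sq b u) (add_mset p A))) =
          (\<Prod>u\<in>square_residues b. (if u = v then v else 1) * u ^ size (filter_mset (\<lambda>p. p \<in> primes_sq b u) A))"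
      by (rule prod.cong) (auto simp: v')
    also have "\<dots> = v * (\<Prod>u\<in>square_residues b. u ^ size (filter_mset (\<lambda>p. p \<in> primes_sq b u) A))"
      using v by (simp add: prod.distrib)
    also have "[\<dots> = p\<^sup>2 * (prod_mset A)\<^sup>2] (mod b)"
      using v add by (intro cong_mult) (auto simp: primes_sq_def cong_sym)
    finally show ?case by (simp add: power_mult_distrib)
  qed auto
  from this[of "prime_factorization g"] show ?thesis
    using g UN_primes_sq[OF b] 
    unfolding coprime_nats_eq_naturals_over[OF b]
    by (auto simp: factor_type_def size_part_over naturals_over_def prod_mset_prime_factorization_nat cong: prod.cong)
qed

lemma ex_submset_of_size:
  assumes "n \<le> size M"
  shows   "\<exists>A. A \<subseteq># M \<and> size A = n"
proof -
  obtain xs where xs: "M = mset xs" using ex_mset by metis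
  have "mset (take n xs) \<subseteq># mset (take n xs @ drop n xs)"
    unfolding mset_append by (rule mset_subset_eq_add_left)
  thus ?thesis using assms by (intro exI[of _ "mset (take n xs)"]) (simp add: xs)
qed

text \<open>A divisor \<open>g\<close> of \<open>M\<close> splits the type of \<open>M\<close> into those of \<open>g\<close> and \<open>M / g\<close>. Conversely, if the type
  of \<open>M\<close> dominates a tuple \<open>v\<close>, then selecting \<open>v\<^sub>u\<close> of the prime factors with square \<open>u\<close>, for each
  \<open>u\<close>, gives a divisor of type \<open>v\<close>. In both cases the type of the divisor fixes its square modulo
  \<open>b\<close>.\<close>

lemma tuples_T_factor_type:
  assumes b: "b > 0" and M: "M \<in> coprime_nats b" and t: "t \<in> square_residues b"
  shows "factor_type b M \<in> tuples_T b t \<longleftrightarrow> t \<in> divisor_squares b M"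
proof
  assume "t \<in> divisor_squares b M"
  then obtain g where g: "g dvd M" "t = g\<^sup>2 mod b" by (auto simp: divisor_squares_def)
  then obtain k where k: "M = g * k" by auto
  have gk: "g \<in> coprime_nats b" "g > 0" "k > 0"
    using M k by (auto simp: coprime_nats_def)
  have "factor_type b g \<in> tuples_S b t"
    using prod_square_residues_factor_type[OF b gk(1)] factor_type_in_tuples g(2)
    by (simp add: tuples_S_def cong_def)
  moreover have "factor_type b M = (\<lambda>u\<in>square_residues b. factor_type b g u + factor_type b k u)"
    using gk by (auto simp: factor_type_def size_part_over k prime_factorization_mult)
  ultimately show "factor_type b M \<in> tuples_T b t"
    unfolding tuples_T_def using factor_type_in_tuples by blast
next
  assume "factor_type b M \<in> tuples_T b t"
  then obtain v w where v: "v \<in> tuples_S b t"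
    and vw: "factor_type b M = (\<lambda>u\<in>square_residues b. v u + w u)"
    by (auto simp: tuples_T_def)
  let ?P = "\<lambda>u. filter_mset (\<lambda>p. p \<in> primes_sq b u) (prime_factorization M)"
  have "\<exists>A. A \<subseteq># ?P u \<and> size A = v u" if "u \<in> square_residues b" for u
  proof -
    have "v u \<le> size (?P u)"
      using fun_cong[OF vw, of u] that by (simp add: factor_type_def size_part_over)
    thus ?thesis
      by (rule ex_submset_of_size)
  qed
  then obtain A where A: "A u \<subseteq># ?P u" "size (A u) = v u" if "u \<in> square_residues b" for u
    by metis
  let ?g = "\<lambda>u. prod_mset (A u)"
  let ?U = "square_residues b"
  have prime: "prime p" if "p \<in># A u" "u \<in> ?U" for u p
    using mset_subset_eqD[OF A(1)[OF that(2)] that(1)] by auto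
  have pf: "prime_factorization (?g u) = A u" if "u \<in> ?U" for u
    by (rule prime_factorization_prod_mset_primes) (use prime that in auto)
  have over: "?g u \<in> naturals_over (primes_sq b u)" if "u \<in> ?U" for u
  proof -
    have "?g u \<noteq> 0" using prime[of 0 u] that by auto
    hence "?g u > 0" by (rule neq0_conv[THEN iffD1])
    thus ?thesis using pf[OF that] A(1)[OF that]
      by (auto simp: naturals_over_def dest: mset_subset_eqD)
  qed
  have M0: "M > 0" using M by (simp add: coprime_nats_def)
  have dvd: "?g u dvd part_over (primes_sq b u) M" if "u \<in> ?U" for u
    unfolding part_over_def by (rule prod_mset_subset_imp_dvd) (rule A(1)[OF that])
  let ?m = "\<Prod>u\<in>?U. ?g u"
  have "?m dvd (\<Prod>u\<in>?U. part_over (primes_sq b u) M)"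
    by (rule prod_dvd_prod) (rule dvd)
  also have "\<dots> = M"
    using part_over_UN[OF finite_square_residues disjoint_primes_sq, of b M] M
    unfolding coprime_nats_eq_naturals_over[OF b] by (simp add: part_over_self)
  finally have m: "?m dvd M" .
  have m_cop: "?m \<in> coprime_nats b"
    using M m by (rule coprime_nats_dvd)
  have "factor_type b ?m u = v u" if u: "u \<in> ?U" for u
  proof -
    have "part_over (primes_sq b u) ?m = ?g u"
      by (rule part_over_prod_block[OF finite_square_residues disjoint_primes_sq over u])
    thus ?thesis using u pf[OF u] A(2)[OF u] by (simp add: factor_type_def)
  qed
  hence "(\<Prod>u\<in>?U. u ^ factor_type b ?m u) = (\<Prod>u\<in>?U. u ^ v u)" by simp
  hence "[?m\<^sup>2 = t] (mod b)"
    using v prod_square_residues_factor_type[OF b m_cop] by (simp add: tuples_S_def cong_def)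
  hence "t = ?m\<^sup>2 mod b" using square_residues_props(1)[OF t b] by (simp add: cong_def)
  thus "t \<in> divisor_squares b M" using m by (auto simp: divisor_squares_def)
qed

lemma divisor_squares_subset:
  assumes "b > 0" "M \<in> coprime_nats b"
  shows   "divisor_squares b M \<subseteq> square_residues b"
  using square_mod_in_square_residues[OF assms(1)] coprime_nats_dvd[OF assms(2)]
  by (auto simp: divisor_squares_def coprime_nats_def)

lemma c_coeff_factor_type:
  assumes "b > 0" "M \<in> coprime_nats b"
  shows   "c_coeff b (factor_type b M) + card (divisor_squares b M) = card (square_residues b)"
proof -
  have "{t\<in>square_residues b. factor_type b M \<notin> tuples_T b t} = square_residues b - divisor_squares b M"
    using tuples_T_factor_type[OF assms] by auto
  moreover have "card (divisor_squares b M) \<le> card (square_residues b)"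
    using divisor_squares_subset[OF assms] by (simp add: card_mono)
  ultimately show ?thesis
    using divisor_squares_subset[OF assms]
    by (simp add: c_coeff_def card_Diff_subset finite_subset[OF _ finite_square_residues])
qed

lemma euler_prod_coprime_nats:
  assumes "b > 0" "Re s > 1"
  shows   "(\<Prod>u\<in>square_residues b. euler_prod (primes_sq b u) s) = infsum (dpow s) (coprime_nats b)"
    and   "infsum (dpow s) (coprime_nats b) \<noteq> 0"
proof -
  have E: "euler_prod (primes_sq b u) s = infsum (dpow s) {n\<in>naturals_over (primes_sq b u). True}"
    "euler_prod (primes_sq b u) s \<noteq> 0" for u
    using euler_prod_dpow[of "primes_sq b u" s] assms(2) by (auto simp: primes_sq_def)
  show *: "(\<Prod>u\<in>square_residues b. euler_prod (primes_sq b u) s) = infsum (dpow s) (coprime_nats b)"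
    unfolding E(1) coprime_nats_eq_naturals_over[OF assms(1)]
    by (subst prod_infsum_naturals_over) (use assms disjoint_primes_sq in auto)
  show "infsum (dpow s) (coprime_nats b) \<noteq> 0"
    unfolding *[symmetric] using E(2) by simp
qed

text \<open>Multiplying by \<open>\<zeta>\<^sub>b(s)\<close> removes the Euler products from the term of \<open>w\<close>, and the remaining product of
  symmetric functions is the sum over the integers of type \<open>w\<close>.\<close>

lemma W_term_fibre:
  assumes b: "b > 0" and s: "Re s > 1" and w: "w \<in> tuples b"
  shows   "W_term b s w * infsum (dpow s) (coprime_nats b) =
             infsum (\<lambda>M. of_nat (c_coeff b (factor_type b M)) * dpow s M)
               {M \<in> coprime_nats b. factor_type b M = w}"
proof -
  let ?U = "square_residues b"
  have "(\<Prod>u\<in>?U. Sym (w u) (primes_sq b u) (dpow s)) =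
          (\<Prod>u\<in>?U. infsum (dpow s) {n\<in>naturals_over (primes_sq b u). size (prime_factorization n) = w u})"
    by (intro prod.cong refl Sym_dpow) (auto simp: primes_sq_def)
  also have "\<dots> = infsum (dpow s) {n\<in>naturals_over (\<Union>u\<in>?U. primes_sq b u).
                    \<forall>u\<in>?U. size (prime_factorization (part_over (primes_sq b u) n)) = w u}"
    by (rule prod_infsum_naturals_over) (use s disjoint_primes_sq in auto)
  also have "{n\<in>naturals_over (\<Union>u\<in>?U. primes_sq b u).
               \<forall>u\<in>?U. size (prime_factorization (part_over (primes_sq b u) n)) = w u} =
             {M \<in> coprime_nats b. factor_type b M = w}"
    using w unfolding coprime_nats_eq_naturals_over[OF b]
    by (auto simp: factor_type_def tuples_def fun_eq_iff PiE_def extensional_def)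
  finally have "W_term b s w * infsum (dpow s) (coprime_nats b) =
     of_nat (c_coeff b w) * infsum (dpow s) {M \<in> coprime_nats b. factor_type b M = w}"
    using euler_prod_coprime_nats[OF b s]
    by (simp add: W_term_def prod_dividef dpow_def [abs_def])
  also have "\<dots> = infsum (\<lambda>M. of_nat (c_coeff b w) * dpow s M) {M \<in> coprime_nats b. factor_type b M = w}"
    by (rule infsum_cmult_right'[symmetric])
  also have "\<dots> = infsum (\<lambda>M. of_nat (c_coeff b (factor_type b M)) * dpow s M)
                    {M \<in> coprime_nats b. factor_type b M = w}"
    by (rule infsum_cong) auto
  finally show ?thesis .
qed

lemma card_weighted_abs_summable:
  assumes "\<And>M. M \<in> A \<Longrightarrow> k M \<le> C" "Re s > 1"
  shows   "(\<lambda>M. of_nat (k M) * dpow s M) abs_summable_on A"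
proof (rule Infinite_Sum.abs_summable_on_comparison_test)
  show "(\<lambda>M. of_nat C * dpow s M) abs_summable_on A"
    using summable_on_cmult_right[OF dpow_abs_summable[OF assms(2)], of "of_nat C"]
    by (simp add: norm_mult)
  show "norm (of_nat (k M) * dpow s M) \<le> norm (of_nat C * dpow s M)" if "M \<in> A" for M
    using assms(1)[OF that] by (simp add: norm_mult mult_right_mono)
qed

text \<open>Summing \<open>W_term_fibre\<close> over all types recovers the series of the numbers
  \<open>c\<^sub>b(w)\<close> over all integers coprime to \<open>b\<close>; subtracting it from \<open>|U\<^sub>b\<^sup>2| \<zeta>\<^sub>b(s)\<close> leaves the numbers of
  squares.\<close>

lemma W_term_sum:
  assumes b: "b > 0" and s: "Re s > 1"
  shows   "W_term b s summable_on tuples b"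
    and   "(of_nat (card (square_residues b)) - infsum (W_term b s) (tuples b)) *
             infsum (dpow s) (coprime_nats b) =
           infsum (\<lambda>M. of_nat (card (divisor_squares b M)) * dpow s M) (coprime_nats b)"
proof -
  let ?Z = "infsum (dpow s) (coprime_nats b)"
  let ?N = "card (square_residues b)"
  let ?F = "\<lambda>M. of_nat (c_coeff b (factor_type b M)) * dpow s M"
  let ?E = "\<lambda>M. of_nat (card (divisor_squares b M)) * dpow s M"
  have Z: "?Z \<noteq> 0" by (rule euler_prod_coprime_nats(2)[OF assms])
  have c_le: "c_coeff b (factor_type b M) \<le> ?N" if "M \<in> coprime_nats b" for M
    using c_coeff_factor_type[OF b that] by linarith
  have E_le: "card (divisor_squares b M) \<le> ?N" if "M \<in> coprime_nats b" for M
    using c_coeff_factor_type[OF b that] by linarith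
  have summ: "?F summable_on coprime_nats b"
    by (rule abs_summable_summable[OF card_weighted_abs_summable[OF c_le s]])
  have eq: "infsum ?F {M \<in> coprime_nats b. factor_type b M = w} = W_term b s w * ?Z" if "w \<in> tuples b" for w
    using W_term_fibre[OF b s that] by simp
  have img: "factor_type b ` coprime_nats b \<subseteq> tuples b"
    using factor_type_in_tuples by auto
  have "(\<lambda>w. W_term b s w * ?Z) summable_on tuples b"
    using infsum_fibres(1)[OF summ img] eq by (rule summable_on_cong[THEN iffD1, rotated])
  thus W: "W_term b s summable_on tuples b"
    using Z by (simp add: summable_on_cmult_left')
  have "infsum (W_term b s) (tuples b) * ?Z = infsum (\<lambda>w. W_term b s w * ?Z) (tuples b)"
    by (rule infsum_cmult_left'[symmetric])
  also have "\<dots> = infsum (\<lambda>w. infsum ?F {M \<in> coprime_nats b. factor_type b M = w}) (tuples b)"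
    by (rule infsum_cong, rule eq[symmetric])
  also have "\<dots> = infsum ?F (coprime_nats b)"
    by (rule infsum_fibres(2)[OF summ img])
  finally have "(of_nat ?N - infsum (W_term b s) (tuples b)) * ?Z =
      of_nat ?N * ?Z - infsum ?F (coprime_nats b)"
    by (simp add: left_diff_distrib)
  also have "of_nat ?N * ?Z = infsum (\<lambda>M. of_nat ?N * dpow s M) (coprime_nats b)"
    by (rule infsum_cmult_right'[symmetric])
  also have "\<dots> = infsum (\<lambda>M. ?F M + ?E M) (coprime_nats b)"
  proof (rule infsum_cong)
    fix M assume "M \<in> coprime_nats b"
    hence "of_nat ?N = (of_nat (c_coeff b (factor_type b M)) + of_nat (card (divisor_squares b M)) :: complex)"
      by (simp only: c_coeff_factor_type[OF b, symmetric] of_nat_add)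
    thus "of_nat ?N * dpow s M = ?F M + ?E M"
      by (simp only: distrib_right)
  qed
  also have "\<dots> = infsum ?F (coprime_nats b) + infsum ?E (coprime_nats b)"
    by (rule infsum_add[OF summ abs_summable_summable[OF card_weighted_abs_summable[OF E_le s]]])
  finally show "(of_nat ?N - infsum (W_term b s) (tuples b)) * ?Z = infsum ?E (coprime_nats b)"
    by simp
qed

section \<open>The coefficients of the zeta function\<close>

text \<open>The triples \<open>(b, h, M)\<close> over which the coefficients are summed: \<open>b\<close> is the order of the common value
  \<open>t r = n k / B\<close> in \<open>\<rat>/\<int>\<close>, \<open>b h\<close> is the denominator of \<open>r\<close>, and \<open>M\<close> is the product of the
  cofactors \<open>t / h\<close> and \<open>n / (B / b)\<close>. \<open>data_index\<close> recovers the index \<open>m\<close>.\<close>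

definition index_data :: "nat \<Rightarrow> (nat \<times> nat \<times> nat) set" where
  "index_data B = (SIGMA b:{b. b dvd B}. {1..} \<times> coprime_nats b)"

definition data_index :: "nat \<Rightarrow> nat \<times> nat \<times> nat \<Rightarrow> nat" where
  "data_index B = (\<lambda>(b, h, M). B div b * h * M)"

text \<open>The numerators of those \<open>r\<close> counted by the coefficient that have the triple \<open>(b, h, M)\<close>; here \<open>t\<close>
  and \<open>n\<close> stand for the cofactors with product \<open>M\<close>.\<close>

definition admissible_numerators :: "int \<Rightarrow> nat \<times> nat \<times> nat \<Rightarrow> nat set" where
  "admissible_numerators k = (\<lambda>(b, h, M). {\<rho>\<in>{0..<b*h}. coprime \<rho> (b * h) \<and>
     (\<exists>t n. t * n = M \<and> [int t * int \<rho> = int n * k] (mod int b))})"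

lemma finite_data_fibre:
  assumes "B > 0" "m > 0"
  shows   "finite {\<tau>\<in>index_data B. data_index B \<tau> = m}"
proof (rule finite_subset)
  show "{\<tau>\<in>index_data B. data_index B \<tau> = m} \<subseteq> {..B} \<times> {..m} \<times> {..m}"
  proof
    fix \<tau> assume \<tau>: "\<tau> \<in> {\<tau>\<in>index_data B. data_index B \<tau> = m}"
    obtain b h M where bhM: "\<tau> = (b, h, M)" by (cases \<tau>)
    have "b dvd B" and m: "B div b * h * M = m"
      using \<tau> by (auto simp: bhM index_data_def data_index_def)
    moreover have "h dvd m" "M dvd m" unfolding m[symmetric] by simp_all
    ultimately show "\<tau> \<in> {..B} \<times> {..m} \<times> {..m}"
      using dvd_imp_le[of b B] dvd_imp_le[of h m] dvd_imp_le[of M m] assms by (simp add: bhM)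
  qed
qed auto

text \<open>After multiplication by the unit \<open>t\<close> the congruence becomes \<open>t\<^sup>2 \<rho> \<equiv> M k\<close>, which involves only the
  square of the divisor \<open>t\<close>. Different squares give different unit classes for \<open>\<rho>\<close>, each with
  \<open>lift_count b h\<close> lifts.\<close>

lemma card_admissible_numerators:
  assumes b: "b > 0" and h: "h > 0" and M: "M \<in> coprime_nats b" and k: "coprime k (int b)"
  shows "card (admissible_numerators k (b, h, M)) = lift_count b h * card (divisor_squares b M)"
proof -
  \<comment> \<open>a natural number representing the possibly negative \<open>M k\<close> modulo \<open>b\<close>\<close>
  define \<kappa> where "\<kappa> = nat (int M * k mod int b)"
  have \<kappa>: "[int \<kappa> = int M * k] (mod int b)"
    using b by (simp add: \<kappa>_def cong_def)
  have "coprime (int M * k) (int b)"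
    using M k by (simp add: coprime_nats_def)
  hence "coprime (int \<kappa>) (int b)" by (rule cong_imp_coprime[OF cong_sym[OF \<kappa>]])
  hence \<kappa>b: "coprime \<kappa> b" by simp
  let ?E = "\<lambda>\<sigma>. {x\<in>{0..<b*h}. coprime x (b*h) \<and> [x * \<sigma> = \<kappa>] (mod b)}"
  have key: "[int t * int \<rho> = int n * k] (mod int b) \<longleftrightarrow> [\<rho> * (t\<^sup>2 mod b) = \<kappa>] (mod b)"
    if tn: "t * n = M" for t n \<rho>
  proof -
    have "coprime t b" using coprime_nats_dvd[OF M dvdI[OF tn[symmetric]]] by (simp add: coprime_nats_def)
    hence t: "coprime (int t) (int b)" by simp
    have "[int t * int \<rho> = int n * k] (mod int b) \<longleftrightarrow>
          [int t * (int t * int \<rho>) = int t * (int n * k)] (mod int b)"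
      using t by (simp add: cong_mult_lcancel)
    also have "int t * (int t * int \<rho>) = int (\<rho> * t\<^sup>2)" by (simp add: power2_eq_square mult_ac)
    also have "int t * (int n * k) = int M * k" by (simp add: tn[symmetric] mult_ac)
    also have "[int (\<rho> * t\<^sup>2) = int M * k] (mod int b) \<longleftrightarrow> [int (\<rho> * t\<^sup>2) = int \<kappa>] (mod int b)"
      using cong_trans[OF _ cong_sym[OF \<kappa>]] cong_trans[OF _ \<kappa>] by blast
    also have "\<dots> \<longleftrightarrow> [\<rho> * t\<^sup>2 = \<kappa>] (mod b)" by (rule cong_int_iff)
    also have "\<dots> \<longleftrightarrow> [\<rho> * (t\<^sup>2 mod b) = \<kappa>] (mod b)"
      by (simp add: cong_def mod_mult_right_eq)
    finally show ?thesis .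
  qed
  have UN: "admissible_numerators k (b, h, M) = (\<Union>\<sigma>\<in>divisor_squares b M. ?E \<sigma>)"
  proof (intro subset_antisym subsetI)
    fix \<rho> assume "\<rho> \<in> admissible_numerators k (b, h, M)"
    then obtain t n where *: "\<rho> \<in> {0..<b*h}" "coprime \<rho> (b * h)" "t * n = M"
      "[int t * int \<rho> = int n * k] (mod int b)"
      unfolding admissible_numerators_def prod.case by blast
    have "[\<rho> * (t\<^sup>2 mod b) = \<kappa>] (mod b)" using key[OF *(3)] *(4) by blast
    moreover have "t\<^sup>2 mod b \<in> divisor_squares b M" using *(3) by (auto simp: divisor_squares_def)
    ultimately show "\<rho> \<in> (\<Union>\<sigma>\<in>divisor_squares b M. ?E \<sigma>)" using * by blast
  next
    fix \<rho> assume "\<rho> \<in> (\<Union>\<sigma>\<in>divisor_squares b M. ?E \<sigma>)"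
    then obtain t where *: "\<rho> \<in> {0..<b*h}" "coprime \<rho> (b * h)" "t dvd M"
      "[\<rho> * (t\<^sup>2 mod b) = \<kappa>] (mod b)" unfolding divisor_squares_def by blast
    obtain n where n: "t * n = M" using *(3) by (elim dvdE) (rule that, rule sym)
    have "[int t * int \<rho> = int n * k] (mod int b)" using *(4) key[OF n] by blast
    hence "\<exists>t n. t * n = M \<and> [int t * int \<rho> = int n * k] (mod int b)" using n by blast
    thus "\<rho> \<in> admissible_numerators k (b, h, M)"
      using *(1,2) unfolding admissible_numerators_def prod.case by blast
  qed
  have "card (\<Union>\<sigma>\<in>divisor_squares b M. ?E \<sigma>) = (\<Sum>\<sigma>\<in>divisor_squares b M. card (?E \<sigma>))"
  proof (rule card_UN_disjoint)
    show "finite (divisor_squares b M)"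
      by (rule finite_subset[OF divisor_squares_subset[OF b M] finite_square_residues])
    show "\<forall>\<sigma>\<in>divisor_squares b M. \<forall>\<sigma>'\<in>divisor_squares b M. \<sigma> \<noteq> \<sigma>' \<longrightarrow> ?E \<sigma> \<inter> ?E \<sigma>' = {}"
    proof (intro ballI impI)
      fix \<sigma> \<sigma>' assume \<sigma>: "\<sigma> \<in> divisor_squares b M" "\<sigma>' \<in> divisor_squares b M" "\<sigma> \<noteq> \<sigma>'"
      have lt: "\<sigma> < b" "\<sigma>' < b" using \<sigma> b by (auto simp: divisor_squares_def)
      show "?E \<sigma> \<inter> ?E \<sigma>' = {}"
      proof (rule ccontr)
        assume "?E \<sigma> \<inter> ?E \<sigma>' \<noteq> {}"
        then obtain x where x: "coprime x (b * h)" "[x * \<sigma> = \<kappa>] (mod b)" "[x * \<sigma>' = \<kappa>] (mod b)"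
          by blast
        hence "[x * \<sigma> = x * \<sigma>'] (mod b)" by (simp add: cong_def)
        hence "[\<sigma> = \<sigma>'] (mod b)" using x(1) by (simp add: cong_mult_lcancel_nat)
        thus False using lt \<sigma>(3) by (simp add: cong_def)
      qed
    qed
  qed simp
  also have "\<dots> = (\<Sum>\<sigma>\<in>divisor_squares b M. lift_count b h)"
  proof (rule sum.cong[OF refl])
    fix \<sigma> assume "\<sigma> \<in> divisor_squares b M"
    hence "\<sigma> \<in> square_residues b" using divisor_squares_subset[OF b M] by (rule subsetD[rotated])
    hence "coprime \<sigma> b" using b by (rule square_residues_props(2))
    then obtain c' where c': "coprime c' b" "?E \<sigma> = unit_lifts b h (\<kappa> * c')"
      by (rule card_scaled_lifts[OF b])
    have "coprime (\<kappa> * c') b" using \<kappa>b c'(1) by simp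
    thus "card (?E \<sigma>) = lift_count b h"
      unfolding c'(2) by (rule card_unit_lifts[OF b h])
  qed
  finally show ?thesis unfolding UN by (simp only: sum_constant of_nat_id mult.commute)
qed

text \<open>If \<open>b = B / gcd(n, B)\<close> is the order of \<open>n k / B\<close> modulo \<open>1\<close>, then \<open>t \<rho> / N\<close> has the same order. As
  \<open>\<rho>\<close> is coprime to \<open>N\<close>, this gives \<open>b\<close> dividing \<open>N\<close> and \<open>N\<close> dividing \<open>t b\<close>; the congruence remains
  after cancellation.\<close>

lemma congruence_data:
  fixes t n \<rho> N B :: nat and k :: int
  assumes k: "coprime k (int B)" and B: "B > 0" and N: "N > 0" and \<rho>: "coprime \<rho> N"
    and t: "t > 0" and n: "n > 0"
    and int: "of_nat t * (of_nat \<rho> / of_nat N) - of_nat n * (of_int k / of_nat B) \<in> (\<int> :: rat set)"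
  obtains b h t' n' where "b dvd B" "N = b * h" "t = h * t'" "n = B div b * n'" "coprime (t' * n') b"
    "[int t' * int \<rho> = int n' * k] (mod int b)"
proof -
  define g where "g = gcd n B"
  obtain n' b where g: "n = n' * g" "B = b * g" "coprime n' b"
    using gcd_coprime_exists[of n B] n unfolding g_def by auto
  have pos: "g > 0" "b > 0" using g B by auto
  have kb: "coprime k (int b)" using k g(2) by simp
  obtain z :: int where z: "of_nat t * (of_nat \<rho> / of_nat N) - of_nat n * (of_int k / of_nat B) = (of_int z :: rat)"
    using int by (auto elim: Ints_cases)
  have "of_nat t * of_nat \<rho> * of_nat b - of_nat n' * of_int k * of_nat N = (of_int z * of_nat N * of_nat b :: rat)"
    using z N pos unfolding g(1,2) by (simp add: field_simps)
  hence "(of_int (int t * int \<rho> * int b - int n' * k * int N) :: rat) = of_int (z * int N * int b)"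
    by simp
  hence eq: "int t * int \<rho> * int b - int n' * k * int N = z * int N * int b"
    unfolding of_int_eq_iff .
  have "int n' * k * int N = int b * (int t * int \<rho> - z * int N)"
    using eq by algebra
  hence "int b dvd int n' * k * int N" by (rule dvdI)
  moreover have "coprime (int b) (int n' * k)" using g(3) kb by (simp add: coprime_commute)
  ultimately have "int b dvd int N" by (simp only: coprime_dvd_mult_right_iff)
  then obtain h where h: "N = b * h" by auto
  have h0: "h > 0" using h N by simp
  have "int \<rho> * (int t * int b) = int N * (int n' * k + z * int b)"
    using eq by algebra
  hence "int N dvd int \<rho> * (int t * int b)" by (rule dvdI)
  moreover have "coprime (int N) (int \<rho>)" using \<rho> by (simp add: coprime_commute)
  ultimately have "int N dvd int t * int b" by (simp only: coprime_dvd_mult_right_iff)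
  hence "int N dvd int (t * b)" by simp
  hence "b * h dvd b * t" unfolding h int_dvd_int_iff by (simp add: mult.commute)
  hence "h dvd t" using pos by simp
  then obtain t' where t': "t = h * t'" by blast
  have "int b * int h * (int t' * int \<rho>) = int b * int h * (int n' * k + z * int b)"
    using eq unfolding h t' of_nat_mult by algebra
  hence "int t' * int \<rho> = int n' * k + z * int b"
    using pos h0 by simp
  hence cong: "[int t' * int \<rho> = int n' * k] (mod int b)"
    by (simp add: cong_def)
  have "coprime (int n' * k) (int b)" using g(3) kb by simp
  hence "coprime (int t' * int \<rho>) (int b)" by (rule cong_imp_coprime[OF cong_sym[OF cong]])
  hence "coprime t' b" by simp
  hence "coprime (t' * n') b" using g(3) by simp
  moreover have "n = B div b * n'" using g pos by simp
  moreover have "b dvd B" using g by simp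
  ultimately show ?thesis using that h t' cong by blast
qed

lemma lowest_terms_unique:
  fixes \<rho> \<rho>' N N' :: nat
  assumes "of_nat \<rho> / of_nat N = (of_nat \<rho>' / of_nat N' :: rat)" "N > 0" "N' > 0"
    "coprime \<rho> N" "coprime \<rho>' N'"
  shows "\<rho> = \<rho>'" "N = N'"
proof -
  have "of_nat (\<rho> * N') = (of_nat (\<rho>' * N) :: rat)" using assms by (simp add: field_simps)
  hence "\<rho> * N' = \<rho>' * N" by (simp only: of_nat_eq_iff)
  thus "\<rho> = \<rho>'" "N = N'" using coprime_crossproduct_nat[OF assms(4,5)] by auto
qed

lemma lowest_terms_exist:
  fixes r :: rat
  assumes "0 \<le> r" "r < 1"
  obtains \<rho> N :: nat where "N > 0" "\<rho> < N" "coprime \<rho> N" "r = of_nat \<rho> / of_nat N"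
proof -
  obtain a b where ab: "r = Fract a b" "b > 0" "coprime a b" by (rule Rat_cases)
  have r: "r = of_int a / of_int b" using ab by (simp add: Fract_of_int_quotient)
  have "a \<ge> 0" using assms(1) ab(2) by (simp add: r zero_le_divide_iff)
  have "a < b" using assms(2) ab(2) by (simp add: r)
  show ?thesis
  proof (rule that[of "nat b" "nat a"])
    show "coprime (nat a) (nat b)"
      using ab \<open>a \<ge> 0\<close> by (simp flip: coprime_int_iff)
  qed (use ab \<open>a \<ge> 0\<close> \<open>a < b\<close> r in auto)
qed

text \<open>The number \<open>M / b\<^sup>2 = m / (B b h)\<close> depends only on \<open>m\<close>, \<open>B\<close> and the denominator \<open>b h\<close>, and it is
  written in lowest terms, so it determines \<open>M\<close> and \<open>b\<close>.\<close>

lemma data_unique: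
  assumes "(b, h, M) \<in> index_data B" "(b', h', M') \<in> index_data B" "B > 0"
    and "data_index B (b, h, M) = data_index B (b', h', M')" "b * h = b' * h'"
  shows "b = b'" "h = h'" "M = M'"
proof -
  have dvd: "b dvd B" "b' dvd B" and hpos: "h > 0" "h' > 0" and M: "M > 0" "M' > 0" "coprime M b" "coprime M' b'"
    using assms(1,2) by (auto simp: index_data_def coprime_nats_def)
  have bpos: "b > 0" "b' > 0" using dvd_pos_nat[OF assms(3)] dvd by blast+
  obtain c c' where c: "B = b * c" "B = b' * c'" using dvd by (elim dvdE)
  have "B div b = c" unfolding c(1) using bpos by simp
  moreover have "B div b' = c'" unfolding c(2) using bpos by simp
  ultimately have eq: "c * h * M = c' * h' * M'" using assms(4) by (simp add: data_index_def)
  have "B * (b * h) * (M * b'\<^sup>2) = (c * h * M) * (b * b * b'\<^sup>2)"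
    unfolding c(1) by (simp only: mult_ac)
  also have "\<dots> = (c' * h' * M') * (b' * b' * b\<^sup>2)"
    unfolding eq by (simp only: power2_eq_square mult_ac)
  also have "\<dots> = B * (b' * h') * (M' * b\<^sup>2)"
    unfolding c(2) by (simp only: mult_ac)
  finally have "M * b'\<^sup>2 = M' * b\<^sup>2"
    using assms(3,5) bpos hpos by simp
  hence "b'\<^sup>2 = b\<^sup>2 \<and> M = M'"
    using coprime_crossproduct_nat[of M "b\<^sup>2" M' "b'\<^sup>2"] M by auto
  thus "b = b'" "M = M'" using bpos by auto
  thus "h = h'" using assms(5) bpos by simp
qed

text \<open>The condition on \<open>r = \<rho> / N\<close> gives a triple by \<open>congruence_data\<close>, and conversely
  \<open>(t \<rho> - n k) / b\<close> is the integer required for \<open>h t\<close> and \<open>(B / b) n\<close>. No \<open>r\<close> is counted twice, since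
  it determines its denominator \<open>b h\<close>, and this determines the triple.\<close>

lemma card_admissible_rationals:
  assumes k: "coprime k (int B)" and B: "B > 0" and m: "m > 0"
  shows "card {r :: rat. 0 \<le> r \<and> r < 1 \<and>
           (\<exists>t n. t * n = m \<and> of_nat t * r - of_nat n * (of_int k / of_nat B) \<in> \<int>)} =
         (\<Sum>(b, h, M)\<in>{\<tau>\<in>index_data B. data_index B \<tau> = m}.
            lift_count b h * card (divisor_squares b M))"
proof -
  let ?Y = "{r :: rat. 0 \<le> r \<and> r < 1 \<and>
           (\<exists>t n. t * n = m \<and> of_nat t * r - of_nat n * (of_int k / of_nat B) \<in> \<int>)}"
  let ?T = "{\<tau>\<in>index_data B. data_index B \<tau> = m}"
  define frac_of :: "nat \<times> nat \<times> nat \<Rightarrow> nat \<Rightarrow> rat"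
    where "frac_of = (\<lambda>(b, h, M) \<rho>. of_nat \<rho> / of_nat (b * h))"
  let ?Z = "\<lambda>\<tau>. frac_of \<tau> ` admissible_numerators k \<tau>"
  have T: "b dvd B" "b > 0" "h > 0" "M > 0" "M \<in> coprime_nats b" "B div b * h * M = m" "coprime k (int b)"
    if "(b, h, M) \<in> ?T" for b h M
  proof -
    show "b dvd B" "h > 0" "M > 0" "M \<in> coprime_nats b" "B div b * h * M = m"
      using that by (auto simp: index_data_def data_index_def coprime_nats_def)
    show "b > 0" using dvd_pos_nat[OF B \<open>b dvd B\<close>] .
    have "int b dvd int B" using \<open>b dvd B\<close> by simp
    from coprime_divisors[OF dvd_refl this k] show "coprime k (int b)" .
  qed
  have UN: "?Y = (\<Union>\<tau>\<in>?T. ?Z \<tau>)"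
  proof (intro subset_antisym subsetI)
    fix r assume r: "r \<in> ?Y"
    then obtain t n where tn: "t * n = m" "of_nat t * r - of_nat n * (of_int k / of_nat B) \<in> \<int>" by blast
    obtain \<rho> N where N: "N > 0" "\<rho> < N" "coprime \<rho> N" "r = of_nat \<rho> / of_nat N"
      using lowest_terms_exist r by blast
    have pos: "t > 0" "n > 0" using tn(1) m by (auto intro!: Nat.gr0I)
    obtain b h t' n' where *: "b dvd B" "N = b * h" "t = h * t'" "n = B div b * n'" "coprime (t' * n') b"
      "[int t' * int \<rho> = int n' * k] (mod int b)"
      using congruence_data[OF k B N(1,3) pos] tn(2) unfolding N(4) by blast
    let ?\<tau> = "(b, h, t' * n')"
    have "h > 0" "t' > 0" "n' > 0" using * pos by (auto intro!: Nat.gr0I)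
    moreover have "B div b * h * (t' * n') = m" using tn(1) * by (simp add: mult_ac)
    ultimately have "?\<tau> \<in> ?T" using * by (simp add: index_data_def data_index_def coprime_nats_def)
    moreover have "\<rho> \<in> admissible_numerators k ?\<tau>"
      using N * unfolding admissible_numerators_def by auto
    moreover have "r = frac_of ?\<tau> \<rho>" using N(4) *(2) by (simp add: frac_of_def)
    ultimately show "r \<in> (\<Union>\<tau>\<in>?T. ?Z \<tau>)" by blast
  next
    fix r assume "r \<in> (\<Union>\<tau>\<in>?T. ?Z \<tau>)"
    then obtain \<tau> \<rho> where "\<tau> \<in> ?T" "\<rho> \<in> admissible_numerators k \<tau>" "r = frac_of \<tau> \<rho>" by blast
    moreover obtain b h M where "\<tau> = (b, h, M)" by (cases \<tau>)
    ultimately have \<tau>: "(b, h, M) \<in> ?T" "\<rho> \<in> admissible_numerators k (b, h, M)"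
      "r = frac_of (b, h, M) \<rho>" by (simp_all only:)
    note T = T[OF \<tau>(1)]
    obtain t n where tn: "t * n = M" "[int t * int \<rho> = int n * k] (mod int b)" "\<rho> \<in> {0..<b * h}"
      using \<tau>(2) unfolding admissible_numerators_def prod.case by blast
    have r: "r = of_nat \<rho> / of_nat (b * h)" using \<tau>(3) by (simp add: frac_of_def)
    have "0 \<le> r" unfolding r by simp
    have "r < 1" unfolding r using tn(3) T by (simp add: divide_less_eq flip: of_nat_mult)
    have "(h * t) * (B div b * n) = B div b * h * (t * n)" by (simp only: mult_ac)
    hence "(h * t) * (B div b * n) = m" using tn(1) T(6) by simp
    moreover have "of_nat (h * t) * r - of_nat (B div b * n) * (of_int k / of_nat B) \<in> \<int>"
    proof -
      obtain z where z: "int t * int \<rho> - int n * k = int b * z"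
        using tn(2) by (auto simp: cong_iff_dvd_diff)
      have "of_nat B = (of_nat (B div b) * of_nat b :: rat)"
        using T(1) by (simp flip: of_nat_mult)
      moreover have "B div b > 0" using T(1,2) B by (simp add: div_greater_zero_iff dvd_imp_le)
      ultimately have "of_nat (h * t) * r - of_nat (B div b * n) * (of_int k / of_nat B) =
          (of_int (int t * int \<rho> - int n * k) / of_nat b :: rat)"
        unfolding r using T(2,3) by (simp add: field_simps)
      also have "\<dots> = of_int z" unfolding z using T(2) by simp
      finally show ?thesis by simp
    qed
    ultimately show "r \<in> ?Y" using \<open>0 \<le> r\<close> \<open>r < 1\<close> by blast
  qed
  have "card (\<Union>\<tau>\<in>?T. ?Z \<tau>) = (\<Sum>\<tau>\<in>?T. card (?Z \<tau>))"
  proof (rule card_UN_disjoint)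
    show "finite ?T" by (rule finite_data_fibre[OF B m])
    show "\<forall>\<tau>\<in>?T. finite (?Z \<tau>)" by (auto simp: admissible_numerators_def)
    show "\<forall>\<tau>\<in>?T. \<forall>\<tau>'\<in>?T. \<tau> \<noteq> \<tau>' \<longrightarrow> ?Z \<tau> \<inter> ?Z \<tau>' = {}"
    proof (intro ballI impI, rule ccontr)
      fix \<tau> \<tau>' assume \<tau>: "\<tau> \<in> ?T" "\<tau>' \<in> ?T" "\<tau> \<noteq> \<tau>'" and ne: "?Z \<tau> \<inter> ?Z \<tau>' \<noteq> {}"
      obtain b h M where bhM: "\<tau> = (b, h, M)" by (cases \<tau>)
      obtain b' h' M' where bhM': "\<tau>' = (b', h', M')" by (cases \<tau>')
      obtain \<rho> \<rho>' where \<rho>: "\<rho> \<in> admissible_numerators k \<tau>" "\<rho>' \<in> admissible_numerators k \<tau>'"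
        "frac_of \<tau> \<rho> = frac_of \<tau>' \<rho>'" using ne by blast
      note T1 = T[OF \<tau>(1)[unfolded bhM]] and T2 = T[OF \<tau>(2)[unfolded bhM']]
      have "b * h = b' * h'"
      proof (rule lowest_terms_unique(2))
        show "of_nat \<rho> / of_nat (b * h) = (of_nat \<rho>' / of_nat (b' * h') :: rat)"
          using \<rho>(3) unfolding bhM bhM' frac_of_def by simp
        show "coprime \<rho> (b * h)" "coprime \<rho>' (b' * h')"
          using \<rho>(1,2) unfolding bhM bhM' admissible_numerators_def by auto
      qed (use T1 T2 in auto)
      hence "\<tau> = \<tau>'"
        using data_unique[of b h M B b' h' M'] \<tau> B unfolding bhM bhM' by auto
      thus False using \<tau>(3) by blast
    qed
  qed
  also have "\<dots> = (\<Sum>(b, h, M)\<in>?T. lift_count b h * card (divisor_squares b M))"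
  proof (rule sum.cong[OF refl])
    fix \<tau> assume \<tau>: "\<tau> \<in> ?T"
    obtain b h M where bhM: "\<tau> = (b, h, M)" by (cases \<tau>)
    note T' = T[OF \<tau>[unfolded bhM]]
    have "inj_on (frac_of \<tau>) (admissible_numerators k \<tau>)"
      using T'(2,3) by (intro inj_onI) (simp add: bhM frac_of_def)
    hence "card (?Z \<tau>) = card (admissible_numerators k \<tau>)" by (rule card_image)
    also have "\<dots> = lift_count b h * card (divisor_squares b M)"
      unfolding bhM by (rule card_admissible_numerators[OF T'(2,3,5,7)])
    finally show "card (?Z \<tau>) = (case \<tau> of (b, h, M) \<Rightarrow> lift_count b h * card (divisor_squares b M))"
      by (simp add: bhM)
  qed
  finally show ?thesis unfolding UN .
qed

lemma num_proper_classes_formula: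
  assumes "sublattice L hyp" "B > 0"
    and "range (\<lambda>n::int. of_nat B * of_int n) =
           of_nat (lat_index hyp L) *o ideal_inverse (norm_ideal L)"
    and "m > 0"
  shows "num_proper_classes L m =
         (\<Sum>(b, h, M)\<in>{\<tau>\<in>index_data B. data_index B \<tau> = m}.
            lift_count b h * card (divisor_squares b M))"
proof -
  have "sublattice hyp hyp"
    unfolding sublattice_def using lat_index_lat(1)[of 1 1 1 1 hyp 0 0] add_subgroup_hyp
    by (simp add: hyp_eq_lat)
  then obtain a x d where lat: "a > 0" "d > 0" "L = lat a x d"
    using sublattice_is_lat assms(1) by blast
  obtain k :: int where k: "coprime k (int B)" "x / a = of_int k / of_nat B"
    by (rule lat_offset_lowest_terms[OF assms(1)[unfolded lat(3)] lat(1,2) assms(2) assms(3)[unfolded lat(3)]])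
  show ?thesis
    unfolding lat(3) num_proper_classes_lat[OF assms(1)[unfolded lat(3)] lat(1,2) assms(4)] k(2)
    by (rule card_admissible_rationals[OF k(1) assms(2,4)])
qed

section \<open>The zeta function identity\<close>

theorem theorem1p3:
  fixes L :: "(rat ^ 2) set" and B :: nat and s :: complex
  assumes "sublattice L hyp"
    and "B > 0"
    and "range (\<lambda>n::int. of_nat B * of_int n) =
           of_nat (lat_index hyp L) *o ideal_inverse (norm_ideal L)"
    and "Re s > 2"
  shows "(\<lambda>m. of_nat (num_proper_classes L m) * of_nat m powr (-s)) summable_on {1..} \<and>
         (\<forall>b. b dvd B \<longrightarrow> W_term b s summable_on tuples b) \<and>
         zeta_SL L s =
           zeta (s - 1) * (\<Sum>b | b dvd B. of_nat (B div b) powr (-s) *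
             (of_nat (card (square_residues b)) - (\<Sum>\<^sub>\<infinity>w\<in>tuples b. W_term b s w)))"
proof -
  note B = assms(2) and s = assms(4)
  define f where "f b h = of_nat (lift_count b h) * dpow s h" for b h
  define e where "e b M = of_nat (card (divisor_squares b M)) * dpow s M" for b M
  define F :: "nat \<times> nat \<times> nat \<Rightarrow> complex"
    where "F = (\<lambda>(b, h, M). dpow s (B div b) * (f b h * e b M))"
  have bpos: "b > 0" if "b dvd B" for b using that B by (rule dvd_pos_nat[rotated])
  have fin: "finite {b. b dvd B}" using B by simp
  have f: "f b abs_summable_on {1..}" if "b dvd B" for b
    unfolding f_def by (rule lift_count_abs_summable[OF bpos[OF that] s])
  have e: "e b abs_summable_on coprime_nats b" if "b dvd B" for b
    unfolding e_def
  proof (rule card_weighted_abs_summable)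
    show "card (divisor_squares b M) \<le> card (square_residues b)" if "M \<in> coprime_nats b" for M
      using divisor_squares_subset[OF bpos[OF \<open>b dvd B\<close>] that] by (simp add: card_mono)
  qed (use s in simp)
  have fe: "(\<lambda>(h, M). f b h * e b M) abs_summable_on {1..} \<times> coprime_nats b" if "b dvd B" for b
    using f[OF that] e[OF that] by (rule infsum_Times_mult(1))
  have "F abs_summable_on index_data B"
    unfolding index_data_def
  proof (rule Infinite_Sum.abs_summable_on_Sigma_iff[THEN iffD2], intro conjI ballI)
    fix b assume "b \<in> {b. b dvd B}"
    hence "b dvd B" by simp
    from summable_on_cmult_right[OF fe[OF this], of "norm (dpow s (B div b))"]
    show "(\<lambda>y. F (b, y)) abs_summable_on {1..} \<times> coprime_nats b"
      by (simp add: F_def case_prod_unfold norm_mult)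
  qed (use fin in simp)
  hence F: "F summable_on index_data B" by (rule abs_summable_summable)
  have img: "data_index B ` index_data B \<subseteq> {1..}"
  proof (rule image_subsetI)
    fix \<tau> assume \<tau>: "\<tau> \<in> index_data B"
    obtain b h M where bhM: "\<tau> = (b, h, M)" by (cases \<tau>)
    have *: "(b, h, M) \<in> index_data B" using \<tau> bhM by simp
    hence "b dvd B" by (simp add: index_data_def)
    hence "B div b > 0" using bpos B by (simp add: div_greater_zero_iff dvd_imp_le)
    hence "data_index B (b, h, M) > 0"
      using * by (simp add: data_index_def index_data_def coprime_nats_def)
    thus "data_index B \<tau> \<in> {1..}" unfolding bhM by simp
  qed
  have fibre: "infsum F {\<tau>\<in>index_data B. data_index B \<tau> = m} =
      of_nat (num_proper_classes L m) * of_nat m powr (-s)" if "m \<in> {1..}" for m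
  proof -
    have m: "m > 0" using that by simp
    have "infsum F {\<tau>\<in>index_data B. data_index B \<tau> = m} = sum F {\<tau>\<in>index_data B. data_index B \<tau> = m}"
      by (rule infsum_finite[OF finite_data_fibre[OF B m]])
    also have "\<dots> = (\<Sum>(b, h, M)\<in>{\<tau>\<in>index_data B. data_index B \<tau> = m}.
            of_nat (lift_count b h * card (divisor_squares b M)) * dpow s m)"
    proof (rule sum.cong[OF refl])
      fix \<tau> assume "\<tau> \<in> {\<tau>\<in>index_data B. data_index B \<tau> = m}"
      hence m: "m = data_index B \<tau>" by simp
      obtain b h M where bhM: "\<tau> = (b, h, M)" by (cases \<tau>)
      show "F \<tau> = (case \<tau> of (b, h, M) \<Rightarrow>
              of_nat (lift_count b h * card (divisor_squares b M)) * dpow s m)"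
        unfolding m bhM by (simp add: F_def f_def e_def data_index_def dpow_mult)
    qed
    also have "\<dots> = of_nat (num_proper_classes L m) * dpow s m"
      unfolding num_proper_classes_formula[OF assms(1-3) m]
      by (simp add: sum_distrib_right case_prod_unfold)
    finally show ?thesis by (simp add: dpow_def)
  qed
  have summ: "(\<lambda>m. of_nat (num_proper_classes L m) * of_nat m powr (-s)) summable_on {1..}"
    using infsum_fibres(1)[OF F img] by (rule summable_on_cong[THEN iffD1, rotated]) (rule fibre)
  have W: "W_term b s summable_on tuples b" if "b dvd B" for b
    using W_term_sum(1)[OF bpos[OF that], of s] s by simp
  have "zeta_SL L s = infsum (\<lambda>m. infsum F {\<tau>\<in>index_data B. data_index B \<tau> = m}) {1..}"
    unfolding zeta_SL_def by (rule infsum_cong, rule fibre[symmetric])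
  also have "\<dots> = infsum F (index_data B)"
    by (rule infsum_fibres(2)[OF F img])
  also have "\<dots> = infsum (\<lambda>b. infsum (\<lambda>y. F (b, y)) ({1..} \<times> coprime_nats b)) {b. b dvd B}"
    using infsum_Sigma'_banach[of "\<lambda>b y. F (b, y)" "{b. b dvd B}" "\<lambda>b. {1..} \<times> coprime_nats b"] F
    by (simp add: index_data_def)
  also have "\<dots> = (\<Sum>b | b dvd B. infsum (\<lambda>y. F (b, y)) ({1..} \<times> coprime_nats b))"
    using fin by simp
  also have "\<dots> = (\<Sum>b | b dvd B. zeta (s - 1) * (of_nat (B div b) powr (-s) *
             (of_nat (card (square_residues b)) - (\<Sum>\<^sub>\<infinity>w\<in>tuples b. W_term b s w))))"
  proof (rule sum.cong[OF refl])
    fix b assume "b \<in> {b. b dvd B}"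
    hence b: "b dvd B" by simp
    have "infsum (\<lambda>y. F (b, y)) ({1..} \<times> coprime_nats b) =
            dpow s (B div b) * infsum (\<lambda>(h, M). f b h * e b M) ({1..} \<times> coprime_nats b)"
      by (simp add: F_def case_prod_unfold infsum_cmult_right')
    also have "infsum (\<lambda>(h, M). f b h * e b M) ({1..} \<times> coprime_nats b) =
        infsum (f b) {1..} * infsum (e b) (coprime_nats b)"
      using f[OF b] e[OF b] by (rule infsum_Times_mult(2))
    also have "infsum (e b) (coprime_nats b) =
        (of_nat (card (square_residues b)) - (\<Sum>\<^sub>\<infinity>w\<in>tuples b. W_term b s w)) * infsum (dpow s) (coprime_nats b)"
      unfolding e_def by (rule W_term_sum(2)[OF bpos[OF b], symmetric]) (use s in simp)
    also have "infsum (f b) {1..} * \<dots> =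
        (infsum (f b) {1..} * infsum (dpow s) (coprime_nats b)) *
        (of_nat (card (square_residues b)) - (\<Sum>\<^sub>\<infinity>w\<in>tuples b. W_term b s w))"
      by (simp only: mult_ac)
    also have "infsum (f b) {1..} * infsum (dpow s) (coprime_nats b) = zeta (s - 1)"
      unfolding f_def by (rule zeta_shift_conv_lift_count[OF bpos[OF b] s])
    finally show "infsum (\<lambda>y. F (b, y)) ({1..} \<times> coprime_nats b) =
        zeta (s - 1) * (of_nat (B div b) powr (-s) *
             (of_nat (card (square_residues b)) - (\<Sum>\<^sub>\<infinity>w\<in>tuples b. W_term b s w)))"
      by (simp only: dpow_def mult_ac)
  qed
  finally have "zeta_SL L s = zeta (s - 1) * (\<Sum>b | b dvd B. of_nat (B div b) powr (-s) *
             (of_nat (card (square_residues b)) - (\<Sum>\<^sub>\<infinity>w\<in>tuples b. W_term b s w)))"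
    by (simp only: sum_distrib_left)
  thus ?thesis using summ W by blast
qed

end
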